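(* Let $G$ be a metric graph with total length $L(G)$ and path-metric diameter $\operatorname{diam}(G)$. Then $$\frac{4L(G)}{\operatorname{diam}(G)^2}\ \ge\ \lambda_1^{\min}(G)\ \ge\ \frac{4}{\operatorname{diam}(G)}.$$
   Context: A metric graph $G=(V,E,\ell)$ is given by a finite connected graph $(V,E)$ with at least one edge (loops and multiple edges allowed) and edge lengths $\ell:E\to(0,\infty)$: each edge $e$ is (after choosing an orientation) identified with the interval $[0,\ell(e)]$, and $G$ is the compact topological space obtained by gluing endpoints of edges corresponding to the same vertex. $L(G)=\sum_{e\in E}\ell(e)$. The path metric $\varrho(x,y)$ is the arc length of a shortest path from $x$ to $y$, and $\operatorname{diam}(G)=\max_{x,y\in G}\varrho(x,y)$. $dx$ is the Lebesgue measure on $G$. $H^1(G)$ is the space of continuous $f:G\to\mathbb{R}$ whose restriction to every open edge lies in $H^1((0,\ell(e)))$; $q(f,g)=\int_G f'g'\,dx$. A function $f\in H^1(G)$ is harmonic on an open set $O\subset G$ if $q(f,g)=0$ for all $g\in H^1(G)$ with $g\equiv 0$ on $G\setminus O$. For a Borel probability measure $\mu$ on $G$, let $H^1(G,\mu)=\{f\in H^1(G): f \text{ harmonic on } G\setminus\operatorname{supp}\mu\}$, regarded (injectively) as a dense subspace of $L^2(G,\mu)$. $H_\mu$ is the non-negative self-adjoint operator in $L^2(G,\mu)$ associated with the closed form $q|_{H^1(G,\mu)}$: $f\in\operatorname{dom}(H_\mu)$ and $H_\mu f=g$ iff $f\in H^1(G,\mu)$ and $q(f,\varphi)=\int_G g\varphi\,d\mu$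 for all $\varphi\in H^1(G,\mu)$. Its spectrum is discrete; its eigenvalues, counted with multiplicity, are $0=\lambda_0(H_\mu)<\lambda_1(H_\mu)\le\cdots$, with $\lambda_k(H_\mu):=+\infty$ for $k\ge\dim L^2(G,\mu)$. Let $\lambda_k^{\min}(G):=\min_{\mu}\lambda_k(H_\mu)$ over all Borel probability measures $\mu$ on $G$ (attained). *)

theory Defs
  imports
    "HOL-Analysis.Analysis"
    "HOL-Probability.Probability_Measure"
    "HOL-Library.Function_Algebras"
    "Graph_Theory.Digraph_Component"
begin

section \<open>Metric graphs\<close>

text \<open>The arcs of a digraph are the edges with their chosen orientation; connectedness is that
  of the underlying undirected multigraph, and loops and parallel arcs are allowed.\<close>

locale metric_graph = fin_digraph G
  for G :: "('v, 'e) pre_digraph" +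
  fixes len :: "'e \<Rightarrow> real"
  assumes graph_connected: "Digraph_Component.connected G"
    and arcs_nonempty: "arcs G \<noteq> {}"
    and len_pos: "e \<in> arcs G \<Longrightarrow> 0 < len e"

definition total_length :: "('v, 'e) pre_digraph \<Rightarrow> ('e \<Rightarrow> real) \<Rightarrow> real" where
  "total_length G len = (\<Sum>e\<in>arcs G. len e)"

text \<open>A point of the glued space is a vertex or lies in the open edge \<open>(0, len e)\<close> of an arc
  \<open>e\<close>. The gluing map \<open>edge_point G len e\<close> sends the parameters \<open>0\<close> and \<open>len e\<close> of the closed
  edge \<open>[0, len e]\<close> to the tail and the head of \<open>e\<close>.\<close>

datatype ('v, 'e) gpoint = Vertex 'v | Inner 'e real

definition edge_point ::
    "('v, 'e) pre_digraph \<Rightarrow> ('e \<Rightarrow> real) \<Rightarrow> 'e \<Rightarrow> real \<Rightarrow> ('v, 'e) gpoint" where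
  "edge_point G len e t =
     (if t = 0 then Vertex (tail G e) else if t = len e then Vertex (head G e) else Inner e t)"

definition gpoints :: "('v, 'e) pre_digraph \<Rightarrow> ('e \<Rightarrow> real) \<Rightarrow> ('v, 'e) gpoint set" where
  "gpoints G len = Vertex ` verts G \<union> {Inner e t |e t. e \<in> arcs G \<and> 0 < t \<and> t < len e}"

definition gtop :: "('v, 'e) pre_digraph \<Rightarrow> ('e \<Rightarrow> real) \<Rightarrow> ('v, 'e) gpoint topology" where
  "gtop G len = topology (\<lambda>U. U \<subseteq> gpoints G len \<and>
     (\<forall>e\<in>arcs G. openin (top_of_set {0..len e}) {t \<in> {0..len e}. edge_point G len e t \<in> U}))"

lemma openin_gtop:
  "openin (gtop G len) U \<longleftrightarrow> U \<subseteq> gpoints G len \<and>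
     (\<forall>e\<in>arcs G. openin (top_of_set {0..len e}) {t \<in> {0..len e}. edge_point G len e t \<in> U})"
proof -
  let ?P = "\<lambda>U. U \<subseteq> gpoints G len \<and>
     (\<forall>e\<in>arcs G. openin (top_of_set {0..len e}) {t \<in> {0..len e}. edge_point G len e t \<in> U})"
  have "istopology ?P"
    unfolding istopology_def
  proof (intro conjI allI impI)
    fix S T assume "?P S" "?P T"
    moreover have "{t \<in> {0..len e}. edge_point G len e t \<in> S \<inter> T} =
      {t \<in> {0..len e}. edge_point G len e t \<in> S} \<inter> {t \<in> {0..len e}. edge_point G len e t \<in> T}" for e
      by auto
    ultimately show "S \<inter> T \<subseteq> gpoints G len"
      and "\<forall>e\<in>arcs G. openin (top_of_set {0..len e}) {t \<in> {0..len e}. edge_point G len e t \<in> S \<inter> T}"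
      by (auto intro: openin_Int)
  next
    fix \<K> assume K: "\<forall>K\<in>\<K>. ?P K"
    have "{t \<in> {0..len e}. edge_point G len e t \<in> \<Union>\<K>} =
      \<Union> ((\<lambda>K. {t \<in> {0..len e}. edge_point G len e t \<in> K}) ` \<K>)" for e
      by auto
    then show "\<forall>e\<in>arcs G. openin (top_of_set {0..len e}) {t \<in> {0..len e}. edge_point G len e t \<in> \<Union>\<K>}"
      using K by (auto intro!: openin_Union)
    show "\<Union>\<K> \<subseteq> gpoints G len" using K by blast
  qed
  then show ?thesis unfolding gtop_def by (simp add: topology_inverse')
qed

lemma (in wf_digraph) topspace_gtop: "topspace (gtop G len) = gpoints G len"
proof -
  have *: "{t \<in> {0..len e}. edge_point G len e t \<in> gpoints G len} = {0..len e}" if "e \<in> arcs G" for e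
    using that by (auto simp: edge_point_def gpoints_def)
  then have "openin (gtop G len) (gpoints G len)"
    by (auto simp: openin_gtop intro: openin_subtopology_self)
  then show ?thesis
    by (metis openin_gtop openin_subset openin_topspace subset_antisym)
qed

text \<open>A path is a finite concatenation of segments, each running monotonically inside one closed
  edge; \<open>gpath G len x y r\<close> says that such a path of arc length \<open>r\<close> leads from \<open>x\<close> to \<open>y\<close>.\<close>

inductive gpath ::
    "('v, 'e) pre_digraph \<Rightarrow> ('e \<Rightarrow> real) \<Rightarrow> ('v, 'e) gpoint \<Rightarrow> ('v, 'e) gpoint \<Rightarrow> real \<Rightarrow> bool"
  for G len x where
  trivial: "x \<in> gpoints G len \<Longrightarrow> gpath G len x x 0"
| segment: "\<lbrakk>gpath G len x (edge_point G len e s) r; e \<in> arcs G; s \<in> {0..len e}; t \<in> {0..len e}\<rbrakk>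
    \<Longrightarrow> gpath G len x (edge_point G len e t) (r + \<bar>t - s\<bar>)"

definition gdist ::
    "('v, 'e) pre_digraph \<Rightarrow> ('e \<Rightarrow> real) \<Rightarrow> ('v, 'e) gpoint \<Rightarrow> ('v, 'e) gpoint \<Rightarrow> real" where
  "gdist G len x y = Inf {r. gpath G len x y r}"

definition gdiam :: "('v, 'e) pre_digraph \<Rightarrow> ('e \<Rightarrow> real) \<Rightarrow> real" where
  "gdiam G len = Sup {gdist G len x y |x y. x \<in> gpoints G len \<and> y \<in> gpoints G len}"

section \<open>The Sobolev space and the energy form\<close>

definition square_integrable :: "real \<Rightarrow> (real \<Rightarrow> real) \<Rightarrow> bool" where
  "square_integrable a u \<longleftrightarrow> set_borel_measurable lborel {0<..<a} u \<and>
     set_integrable lborel {0<..<a} (\<lambda>t. (u t)\<^sup>2)"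

definition test_function :: "real \<Rightarrow> (real \<Rightarrow> real) \<Rightarrow> bool" where
  "test_function a \<phi> \<longleftrightarrow> (\<forall>n x. (deriv ^^ n) \<phi> differentiable (at x)) \<and>
     (\<exists>c d. 0 < c \<and> d < a \<and> (\<forall>x. x \<notin> {c..d} \<longrightarrow> \<phi> x = 0))"

definition is_weak_deriv :: "real \<Rightarrow> (real \<Rightarrow> real) \<Rightarrow> (real \<Rightarrow> real) \<Rightarrow> bool" where
  "is_weak_deriv a u g \<longleftrightarrow> square_integrable a g \<and>
     (\<forall>\<phi>. test_function a \<phi> \<longrightarrow>
       (LINT t:{0<..<a}|lborel. u t * deriv \<phi> t) = - (LINT t:{0<..<a}|lborel. g t * \<phi> t))"

definition sobolev_interval :: "real \<Rightarrow> (real \<Rightarrow> real) set" where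
  "sobolev_interval a = {u. square_integrable a u \<and> (\<exists>g. is_weak_deriv a u g)}"

text \<open>Weak derivatives are unique up to null sets, so the choice does not affect integrals.\<close>

definition weak_deriv :: "real \<Rightarrow> (real \<Rightarrow> real) \<Rightarrow> real \<Rightarrow> real" where
  "weak_deriv a u = (SOME g. is_weak_deriv a u g)"

text \<open>Functions on the graph are total functions normalised to vanish off its point set. This
  makes the function spaces below vector spaces in which equality means equality on the graph.\<close>

definition H1 :: "('v, 'e) pre_digraph \<Rightarrow> ('e \<Rightarrow> real) \<Rightarrow> (('v, 'e) gpoint \<Rightarrow> real) set" where
  "H1 G len = {f. continuous_map (gtop G len) euclideanreal f \<and> (\<forall>x. x \<notin> gpoints G len \<longrightarrow> f x = 0) \<and>
     (\<forall>e\<in>arcs G. (\<lambda>t. f (edge_point G len e t)) \<in> sobolev_interval (len e))}"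

definition edge_deriv ::
    "('v, 'e) pre_digraph \<Rightarrow> ('e \<Rightarrow> real) \<Rightarrow> (('v, 'e) gpoint \<Rightarrow> real) \<Rightarrow> 'e \<Rightarrow> real \<Rightarrow> real" where
  "edge_deriv G len f e = weak_deriv (len e) (\<lambda>t. f (edge_point G len e t))"

definition energy ::
    "('v, 'e) pre_digraph \<Rightarrow> ('e \<Rightarrow> real) \<Rightarrow> (('v, 'e) gpoint \<Rightarrow> real) \<Rightarrow> (('v, 'e) gpoint \<Rightarrow> real) \<Rightarrow> real" where
  "energy G len f g =
     (\<Sum>e\<in>arcs G. LINT t:{0<..<len e}|lborel. edge_deriv G len f e t * edge_deriv G len g e t)"

definition harmonic_on ::
    "('v, 'e) pre_digraph \<Rightarrow> ('e \<Rightarrow> real) \<Rightarrow> ('v, 'e) gpoint set \<Rightarrow> (('v, 'e) gpoint \<Rightarrow> real) \<Rightarrow> bool" where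
  "harmonic_on G len W f \<longleftrightarrow>
     (\<forall>g\<in>H1 G len. (\<forall>x\<in>gpoints G len - W. g x = 0) \<longrightarrow> energy G len f g = 0)"

section \<open>The operator of a Borel probability measure\<close>

definition borel_prob :: "('v, 'e) pre_digraph \<Rightarrow> ('e \<Rightarrow> real) \<Rightarrow> ('v, 'e) gpoint measure \<Rightarrow> bool" where
  "borel_prob G len \<mu> \<longleftrightarrow> prob_space \<mu> \<and> space \<mu> = gpoints G len \<and>
     sets \<mu> = sigma_sets (gpoints G len) {U. openin (gtop G len) U}"

definition supp ::
    "('v, 'e) pre_digraph \<Rightarrow> ('e \<Rightarrow> real) \<Rightarrow> ('v, 'e) gpoint measure \<Rightarrow> ('v, 'e) gpoint set" where
  "supp G len \<mu> = {x \<in> gpoints G len. \<forall>U. openin (gtop G len) U \<and> x \<in> U \<longrightarrow> 0 < emeasure \<mu> U}"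

definition H1_mu ::
    "('v, 'e) pre_digraph \<Rightarrow> ('e \<Rightarrow> real) \<Rightarrow> ('v, 'e) gpoint measure \<Rightarrow> (('v, 'e) gpoint \<Rightarrow> real) set" where
  "H1_mu G len \<mu> = {f \<in> H1 G len. harmonic_on G len (gpoints G len - supp G len \<mu>) f}"

text \<open>\<open>op_graph G len \<mu> f g\<close> says that \<open>f\<close> is in the domain of the operator \<open>H\<^sub>\<mu>\<close> and \<open>H\<^sub>\<mu> f = g\<close>.
  The element \<open>f\<close> of \<open>L\<^sup>2(\<mu>)\<close> is given by its unique representative in \<open>H1_mu G len \<mu>\<close>, while \<open>g\<close> may
  be any representative.\<close>

definition op_graph ::
    "('v, 'e) pre_digraph \<Rightarrow> ('e \<Rightarrow> real) \<Rightarrow> ('v, 'e) gpoint measure \<Rightarrow>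
     (('v, 'e) gpoint \<Rightarrow> real) \<Rightarrow> (('v, 'e) gpoint \<Rightarrow> real) \<Rightarrow> bool" where
  "op_graph G len \<mu> f g \<longleftrightarrow> f \<in> H1_mu G len \<mu> \<and>
     g \<in> borel_measurable \<mu> \<and> integrable \<mu> (\<lambda>x. (g x)\<^sup>2) \<and>
     (\<forall>\<phi>\<in>H1_mu G len \<mu>. energy G len f \<phi> = (LINT x|\<mu>. g x * \<phi> x))"

definition eigenspace ::
    "('v, 'e) pre_digraph \<Rightarrow> ('e \<Rightarrow> real) \<Rightarrow> ('v, 'e) gpoint measure \<Rightarrow> real \<Rightarrow>
     (('v, 'e) gpoint \<Rightarrow> real) set" where
  "eigenspace G len \<mu> \<nu> = {f. op_graph G len \<mu> f (\<lambda>x. \<nu> * f x)}"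

definition fun_scale :: "real \<Rightarrow> ('a \<Rightarrow> real) \<Rightarrow> 'a \<Rightarrow> real" where
  "fun_scale c f = (\<lambda>x. c * f x)"

lemma vector_space_fun_scale: "vector_space fun_scale"
  by unfold_locales (auto simp: fun_scale_def fun_eq_iff algebra_simps)

text \<open>The multiplicity is \<open>0\<close> when \<open>\<nu>\<close> is not an eigenvalue. The convention \<open>dim = 0\<close> for
  infinite-dimensional spaces is immaterial, as all eigenspaces are finite-dimensional.\<close>

definition eigen_multiplicity ::
    "('v, 'e) pre_digraph \<Rightarrow> ('e \<Rightarrow> real) \<Rightarrow> ('v, 'e) gpoint measure \<Rightarrow> real \<Rightarrow> nat" where
  "eigen_multiplicity G len \<mu> \<nu> = vector_space.dim fun_scale (eigenspace G len \<mu> \<nu>)"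

text \<open>The eigenvalue with index \<open>k\<close>, counted from \<open>0\<close> with multiplicity, is the least real number
  up to which the eigenvalues have total multiplicity exceeding \<open>k\<close>. It is \<open>\<infinity> = Inf {}\<close> if the
  total multiplicity, i.e. the dimension of \<open>L\<^sup>2(\<mu>)\<close>, is at most \<open>k\<close>.\<close>

definition eigenvalue ::
    "('v, 'e) pre_digraph \<Rightarrow> ('e \<Rightarrow> real) \<Rightarrow> ('v, 'e) gpoint measure \<Rightarrow> nat \<Rightarrow> ereal" where
  "eigenvalue G len \<mu> k =
     Inf {ereal \<Lambda> |\<Lambda>. \<exists>F. finite F \<and> F \<subseteq> {..\<Lambda>} \<and> k < (\<Sum>\<nu>\<in>F. eigen_multiplicity G len \<mu> \<nu>)}"

text \<open>A minimum is rendered as the infimum, which equals it whenever it is attained.\<close>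

definition eigenvalue_min :: "('v, 'e) pre_digraph \<Rightarrow> ('e \<Rightarrow> real) \<Rightarrow> nat \<Rightarrow> ereal" where
  "eigenvalue_min G len k = (INF \<mu>\<in>{\<mu>. borel_prob G len \<mu>}. eigenvalue G len \<mu> k)"

end

theory Submission
  imports
    Defs
    "HOL-Computational_Algebra.Polynomial"
    "HOL-Probability.Probability_Mass_Function"
begin

text \<open>Lower bound: let \<open>f\<close> be an eigenfunction for \<open>\<nu> > 0\<close>, with maximum \<open>M\<close> and minimum \<open>m\<close>. Its mean
  is zero, so \<open>\<integral> f\<^sup>2 d\<mu> \<le> - M m \<le> (M - m)\<^sup>2 / 4\<close>, while \<open>(f x - f y)\<^sup>2 \<le> r q(f, f)\<close> for every
  path of length \<open>r\<close> from \<open>x\<close> to \<open>y\<close>. Hence \<open>\<nu> \<integral> f\<^sup>2 d\<mu> = q(f, f) \<ge> (4 / diam G) \<integral> f\<^sup>2 d\<mu>\<close>.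

  Upper bound: for \<open>\<mu> = (\<delta>\<^sub>x + \<delta>\<^sub>y) / 2\<close> the first non-zero eigenvalue is \<open>4 / R\<close>, where \<open>R\<close> is the effective
  resistance between \<open>x\<close> and \<open>y\<close>. If \<open>q(h, g) = g x - g y\<close> for all \<open>g\<close>, then \<open>R = q(h, h)\<close>, and testing with a
  1-Lipschitz function that vanishes at \<open>x\<close> and is at least \<open>\<rho>(x, y)\<close> at \<open>y\<close> gives
  \<open>\<rho>(x, y)\<^sup>2 \<le> R L(G)\<close> by the Cauchy--Schwarz inequality. The function \<open>h\<close> is assembled from a solution
  of the discrete Dirichlet problem on the vertices and from tent functions on the edges
  containing \<open>x\<close> and \<open>y\<close>.\<close>

section \<open>Smooth functions\<close>

text \<open>The weak derivative inside \<open>energy\<close> is an arbitrary choice, characterised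
  only through smooth test functions, so every link between the values of a function and its energy
  must be extracted from that characterisation. This calls for explicit test functions, hence the
  bump functions. Two facts result: increments along an edge are integrals of the weak derivative,
  and explicit weak derivatives may replace the chosen one. The factor 4 has the same origin in both
  bounds: equal masses at two points are the case of equality in the estimate of the second moment
  by \<open>(M - m)^2 / 4\<close>. The total length enters as a bound for the energy of the
  Lipschitz function, whose slopes are at most 1. The lower bound amounts to this: below
  \<open>4 / gdiam G len\<close> the only nonzero eigenfunctions are constants. For the upper bound
  two eigenvalues with one-dimensional eigenspaces are enough. The diameter is a supremum and is
  approached by pairs of points.\<close>

definition smooth :: "(real \<Rightarrow> real) \<Rightarrow> bool" where
  "smooth f \<longleftrightarrow> (\<exists>D. D 0 = f \<and> (\<forall>n x. (D n has_real_derivative D (Suc n) x) (at x)))"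

lemma smooth_affine:
  assumes "smooth f" shows "smooth (\<lambda>x. f (c * x + b))"
proof -
  obtain D where D: "D 0 = f" "\<And>n x. (D n has_real_derivative D (Suc n) x) (at x)"
    using assms unfolding smooth_def by blast
  show ?thesis unfolding smooth_def
    by (rule exI[of _ "\<lambda>n x. c ^ n * D n (c * x + b)"])
      (auto simp: D(1) intro!: derivative_eq_intros DERIV_chain2[OF D(2)])
qed

lemma smooth_diff:
  assumes "smooth f" "smooth g" shows "smooth (\<lambda>x. f x - g x)"
proof -
  obtain D E where D: "D 0 = f" "\<And>n x. (D n has_real_derivative D (Suc n) x) (at x)"
    and E: "E 0 = g" "\<And>n x. (E n has_real_derivative E (Suc n) x) (at x)"
    using assms unfolding smooth_def by blast
  show ?thesis unfolding smooth_def
    by (rule exI[of _ "\<lambda>n x. D n x - E n x"]) (auto simp: D(1) E(1) intro!: derivative_intros D E)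
qed

text \<open>\<open>test_function\<close> speaks of iterated \<open>deriv\<close>, while
  \<open>smooth\<close> records a sequence of successive derivatives, which is easier to exhibit;
  this is the passage from the latter to the former.\<close>

lemma smooth_higher_deriv:
  assumes "smooth f" shows "(deriv ^^ n) f differentiable (at x)"
proof -
  obtain D where D: "D 0 = f" "\<And>n x. (D n has_real_derivative D (Suc n) x) (at x)"
    using assms unfolding smooth_def by blast
  have "(deriv ^^ n) f = D n"
    by (induction n) (auto simp: D(1) intro!: DERIV_imp_deriv D(2))
  then show ?thesis using D(2) real_differentiable_def by metis
qed

lemma smooth_antiderivative:
  assumes "smooth f" "\<And>x. (F has_real_derivative f x) (at x)" shows "smooth F"
proof -
  obtain D where D: "D 0 = f" "\<And>n x. (D n has_real_derivative D (Suc n) x) (at x)"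
    using assms unfolding smooth_def by blast
  show ?thesis unfolding smooth_def
    by (rule exI[of _ "\<lambda>n. case n of 0 \<Rightarrow> F | Suc m \<Rightarrow> D m"])
      (auto simp: D assms(2) split: nat.split)
qed

text \<open>With \<open>w = x * (1 - x)\<close> these are the functions
  \<open>p / w ^ k * exp (- 1 / w)\<close>, extended by zero. The family in \<open>k\<close> and
  \<open>p\<close> is closed under differentiation, unlike the single bump
  \<open>exp (- 1 / w)\<close>.\<close>

definition bump :: "nat \<Rightarrow> real poly \<Rightarrow> real \<Rightarrow> real" where
  "bump k p x = (if 0 < x \<and> x < 1 then poly p x / (x * (1 - x)) ^ k * exp (- 1 / (x * (1 - x))) else 0)"

text \<open>The exponential series at \<open>1 / w\<close> dominates its term of index
  \<open>k + 2\<close>; the two powers beyond \<open>k\<close> leave the factor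
  \<open>w ^ 2\<close>.\<close>

lemma power_mult_exp_bound:
  fixes w :: real assumes "0 < w" shows "exp (- 1 / w) / w ^ k \<le> fact (k + 2) * w ^ 2"
proof -
  have "inverse (fact (k + 2)) * (1 / w) ^ (k + 2) \<le> exp (1 / w)"
    unfolding exp_def using assms sum_le_suminf[OF summable_exp_generic, of "{k + 2}" "1 / w"]
    by simp
  then have "exp (- 1 / w) * (inverse (fact (k + 2)) * (1 / w) ^ (k + 2)) \<le> exp (- 1 / w) * exp (1 / w)"
    by (intro mult_left_mono) auto
  also have "\<dots> = 1" by (simp add: exp_minus)
  finally have "exp (- 1 / w) / w ^ (k + 2) \<le> fact (k + 2)"
    using assms by (simp add: power_one_over divide_simps mult.commute del: fact_Suc power_Suc)
  then have "exp (- 1 / w) / w ^ (k + 2) * w ^ 2 \<le> fact (k + 2) * w ^ 2"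
    by (intro mult_right_mono) auto
  then show ?thesis using assms by (simp add: power_add power2_eq_square del: fact_Suc)
qed

text \<open>Quadratic vanishing at 0 and 1 gives the derivative 0 at these points, where the formula
  for \<open>bump\<close> changes.\<close>

lemma bump_bound: "\<exists>K. \<forall>x. \<bar>bump k p x\<bar> \<le> K * x\<^sup>2 \<and> \<bar>bump k p x\<bar> \<le> K * (x - 1)\<^sup>2"
proof -
  have "bounded (poly p ` {0..1})"
    by (intro compact_imp_bounded compact_continuous_image continuous_intros) auto
  then obtain B where B: "\<And>x. x \<in> {0..1} \<Longrightarrow> \<bar>poly p x\<bar> \<le> B"
    unfolding bounded_iff by (metis imageI real_norm_def)
  have B0: "B \<ge> 0" using B[of 0] by auto
  have "\<bar>bump k p x\<bar> \<le> (B * fact (k + 2)) * x\<^sup>2 \<and> \<bar>bump k p x\<bar> \<le> (B * fact (k + 2)) * (x - 1)\<^sup>2" for x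
  proof (cases "0 < x \<and> x < 1")
    case True
    define w where "w = x * (1 - x)"
    have w: "0 < w" "w \<le> x" "w \<le> 1 - x" using True by (auto simp: w_def mult_left_le mult_le_cancel_right2)
    have "\<bar>bump k p x\<bar> = \<bar>poly p x\<bar> * (exp (- 1 / w) / w ^ k)"
      using True w by (simp add: bump_def w_def abs_mult)
    also have "\<dots> \<le> B * (fact (k + 2) * w ^ 2)"
      using True w B0 by (intro mult_mono B power_mult_exp_bound) auto
    finally have *: "\<bar>bump k p x\<bar> \<le> (B * fact (k + 2)) * w\<^sup>2" by (simp add: mult.assoc)
    have "w\<^sup>2 \<le> x\<^sup>2" "w\<^sup>2 \<le> (x - 1)\<^sup>2" using w
      by (auto simp: power2_commute[of x 1] intro!: power_mono)
    then show ?thesis using * B0 by (meson fact_ge_zero mult_left_mono mult_nonneg_nonneg order_trans)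
  next
    case False then show ?thesis using B0 by (auto simp: bump_def)
  qed
  then show ?thesis by blast
qed

lemma quadratic_bound_imp_DERIV_0:
  fixes f :: "real \<Rightarrow> real"
  assumes "\<And>y. \<bar>f y\<bar> \<le> K * (y - x)\<^sup>2" shows "(f has_real_derivative 0) (at x)"
proof -
  have fx: "f x = 0" using assms[of x] by simp
  have "((\<lambda>y. (f y - f x) / (y - x)) \<longlongrightarrow> 0) (at x)"
  proof (rule Lim_null_comparison)
    show "\<forall>\<^sub>F y in at x. norm ((f y - f x) / (y - x)) \<le> K * \<bar>y - x\<bar>"
      using assms by (intro always_eventually) (auto simp: fx divide_simps power2_eq_square abs_mult mult.assoc)
    show "((\<lambda>y. K * \<bar>y - x\<bar>) \<longlongrightarrow> 0) (at x)"
      by (rule tendsto_eq_intros refl | simp)+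
  qed
  then show ?thesis by (simp add: has_field_derivative_iff)
qed

lemma DERIV_poly_div_power_exp:
  fixes v :: "real \<Rightarrow> real"
  assumes v: "(v has_real_derivative v') (at x)" and "0 < v x"
  shows "((\<lambda>x. poly p x / v x ^ k * exp (- 1 / v x)) has_real_derivative
    (poly (pderiv p) x * (v x)\<^sup>2 - of_nat k * (poly p x * v x * v') + poly p x * v') / v x ^ (k + 2) * exp (- 1 / v x)) (at x)"
proof -
  define W E where "W = v x" and "E = exp (- 1 / v x)"
  have W: "W > 0" using assms by (simp add: W_def)
  have 1: "((\<lambda>x. exp (- 1 / v x)) has_real_derivative E * (v' / W\<^sup>2)) (at x)"
    using assms by (auto intro!: derivative_eq_intros simp: E_def W_def power2_eq_square)
  have 2: "((\<lambda>x. poly p x / v x ^ k) has_real_derivative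
      (poly (pderiv p) x * W ^ k - poly p x * (of_nat k * (v' * W ^ (k - 1)))) / (W ^ k * W ^ k)) (at x)"
    using assms by (auto intro!: derivative_eq_intros simp: W_def)
  have "(poly (pderiv p) x * W ^ k - poly p x * (of_nat k * (v' * W ^ (k - 1)))) / (W ^ k * W ^ k) * E
      + E * (v' / W\<^sup>2) * (poly p x / W ^ k)
    = (poly (pderiv p) x * W\<^sup>2 - of_nat k * (poly p x * W * v') + poly p x * v') / W ^ (k + 2) * E"
    using W by (cases k) (simp_all add: field_simps power2_eq_square power_add)
  then show ?thesis
    using DERIV_mult[OF 2 1] by (simp add: W_def E_def)
qed

lemma DERIV_bump: "\<exists>q. \<forall>x. (bump k p has_real_derivative bump (k + 2) q x) (at x)"
proof (intro exI allI)
  define w :: "real poly" where "w = [:0, 1, -1:]"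
  \<comment> \<open>\<open>q\<close> is the numerator that the quotient and chain rules produce over
    the denominator \<open>w ^ (k + 2)\<close>.\<close>
  define q where "q = pderiv p * w\<^sup>2 - smult (of_nat k) (p * w * pderiv w) + p * pderiv w"
  have w: "poly w x = x * (1 - x)" for x by (simp add: w_def algebra_simps)
  have w': "poly (pderiv w) x = 1 - 2 * x" for x by (simp add: w_def pderiv_pCons)
  fix x :: real
  obtain K where K: "\<And>x. \<bar>bump k p x\<bar> \<le> K * x\<^sup>2" "\<And>x. \<bar>bump k p x\<bar> \<le> K * (x - 1)\<^sup>2"
    using bump_bound by blast
  consider "0 < x" "x < 1" | "x < 0 \<or> x > 1" | "x = 0" | "x = 1" by linarith
  then show "(bump k p has_real_derivative bump (k + 2) q x) (at x)"
  proof cases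
    case 1
    have "((\<lambda>x. x * (1 - x)) has_real_derivative (1 - 2 * x)) (at x)"
      by (auto intro!: derivative_eq_intros)
    from DERIV_poly_div_power_exp[OF this, of p k]
    have "((\<lambda>x. poly p x / (x * (1 - x)) ^ k * exp (- 1 / (x * (1 - x)))) has_real_derivative bump (k + 2) q x) (at x)"
      using 1 by (simp add: bump_def q_def w w' mult.assoc del: power_Suc)
    then show ?thesis
      by (rule has_field_derivative_transform_within_open[of _ _ _ "{0<..<1}"]) (use 1 in \<open>auto simp: bump_def\<close>)
  next
    case 2
    have "((\<lambda>_. 0) has_real_derivative bump (k + 2) q x) (at x)" using 2 by (auto simp: bump_def)
    then show ?thesis
      by (rule has_field_derivative_transform_within_open[of _ _ _ "- {0..1}"])
         (use 2 in \<open>auto simp: bump_def\<close>)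
  next
    case 3
    then show ?thesis using quadratic_bound_imp_DERIV_0[of "bump k p" K 0] K by (auto simp: bump_def)
  next
    case 4
    then show ?thesis using quadratic_bound_imp_DERIV_0[of "bump k p" K 1] K by (auto simp: bump_def)
  qed
qed

text \<open>Differentiation acts on the parameters, sending \<open>(k, p)\<close> to
  \<open>(k + 2, d k p)\<close>; iterating this map supplies all derivatives.\<close>

lemma smooth_bump: "smooth (bump k p)"
proof -
  obtain d where d: "\<And>k p x. (bump k p has_real_derivative bump (k + 2) (d k p) x) (at x)"
    using DERIV_bump by metis
  define D where "D n = ((\<lambda>(k, p). (k + 2, d k p)) ^^ n) (k, p)" for n
  have "(case D (Suc n) of (k, p) \<Rightarrow> bump k p) = (case D n of (k, p) \<Rightarrow> bump (k + 2) (d k p))" for n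
    by (simp add: D_def split: prod.split)
  then show ?thesis unfolding smooth_def
    by (intro exI[of _ "\<lambda>n. case D n of (k, p) \<Rightarrow> bump k p"]) (auto simp: D_def d[simplified] split: prod.split)
qed

text \<open>The step is the antiderivative of \<open>bump 0 1\<close>, shifted and scaled to rise
  from 0 to 1.\<close>

lemma smooth_step_exists:
  obtains \<Theta> :: "real \<Rightarrow> real" where "smooth \<Theta>" "mono \<Theta>" "\<And>x. x \<le> 0 \<Longrightarrow> \<Theta> x = 0" "\<And>x. 1 \<le> x \<Longrightarrow> \<Theta> x = 1"
proof -
  define b where "b = bump 0 1"
  have sb: "smooth b" by (simp add: b_def smooth_bump)
  have b: "b x \<ge> 0" "0 < x \<and> x < 1 \<Longrightarrow> b x > 0" "x \<le> 0 \<or> x \<ge> 1 \<Longrightarrow> b x = 0" for x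
    by (auto simp: b_def bump_def)
  have "isCont b x" for x
    using smooth_higher_deriv[OF sb, of 0 x] by (simp add: differentiable_imp_continuous_within)
  then obtain F where "\<And>x. (F has_vector_derivative b x) (at x)"
    using einterval_antiderivative[of "-\<infinity>" "\<infinity>" b] by auto
  then have F: "(F has_real_derivative b x) (at x)" for x
    by (simp add: has_real_derivative_iff_has_vector_derivative)
  have Fc: "continuous_on A F" for A using F by (meson DERIV_isCont continuous_at_imp_continuous_on)
  have mono: "F x \<le> F y" if "x \<le> y" for x y
    using that F b(1) by (intro DERIV_nonneg_imp_nondecreasing[of x y F]) auto
  have "F 0 < F 1"
    by (rule DERIV_pos_imp_increasing_open[of 0 1 F]) (use F b Fc in auto)
  have F0: "F x = F 0" if "x \<le> 0" for x
  proof (cases "x = 0")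
    case False
    with that show ?thesis
    using DERIV_isconst2[of x 0 F 0] F b(3) Fc by (metis less_eq_real_def order_refl)
  qed auto
  have F1: "F x = F 1" if "x \<ge> 1" for x
  proof (cases "x = 1")
    case False
    with that show ?thesis
    using DERIV_isconst2[of 1 x F x] F b(3) Fc by (metis less_eq_real_def order_refl)
  qed auto
  define c where "c = 1 / (F 1 - F 0)"
  have c: "c > 0" using \<open>F 0 < F 1\<close> by (simp add: c_def)
  have "smooth (\<lambda>x. c * (F x - F 0))"
  proof -
    have "smooth F" using smooth_antiderivative sb F by blast
    then obtain D where D: "D 0 = F" "\<And>n x. (D n has_real_derivative D (Suc n) x) (at x)"
      unfolding smooth_def by blast
    show ?thesis unfolding smooth_def
    proof (intro exI[of _ "\<lambda>n x. c * (D n x - (if n = 0 then F 0 else 0))"] conjI allI)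
      show "((\<lambda>x. c * (D n x - (if n = 0 then F 0 else 0))) has_real_derivative
        c * (D (Suc n) x - (if Suc n = 0 then F 0 else 0))) (at x)" for n x
        using DERIV_cmult[OF DERIV_diff[OF D(2)[of n x] DERIV_const]] by simp
    qed (simp add: D(1))
  qed
  moreover have "mono (\<lambda>x. c * (F x - F 0))" using mono c by (auto intro!: monoI)
  moreover have "c * (F x - F 0) = 0" if "x \<le> 0" for x unfolding F0[OF that] by simp
  moreover have "c * (F x - F 0) = 1" if "1 \<le> x" for x
    unfolding F1[OF that] using \<open>F 0 < F 1\<close> by (simp add: c_def)
  ultimately show ?thesis by (rule that)
qed

section \<open>Weak derivatives on an interval\<close>

lemma smooth_imp_deriv:
  assumes "smooth f"
  shows "(f has_real_derivative deriv f x) (at x)" "continuous_on A f" "continuous_on A (deriv f)"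
proof -
  show *: "(f has_real_derivative deriv f x) (at x)" for x
    using smooth_higher_deriv[OF assms, of 0 x]
    by (simp add: DERIV_deriv_iff_real_differentiable)
  show "continuous_on A f" using * by (meson DERIV_isCont continuous_at_imp_continuous_on)
  show "continuous_on A (deriv f)"
    using smooth_higher_deriv[OF assms, of 1]
    by (auto intro!: continuous_at_imp_continuous_on differentiable_imp_continuous_within)
qed

lemma DERIV_smooth_affine:
  assumes "smooth f"
  shows "((\<lambda>x. f (M * (x - s))) has_real_derivative M * deriv f (M * (x - s))) (at x)"
proof -
  have "((\<lambda>x. M * (x - s)) has_real_derivative M) (at x)" by (auto intro!: derivative_eq_intros)
  from DERIV_chain2[OF smooth_imp_deriv(1)[OF assms] this] show ?thesis by (simp add: mult.commute)
qed

lemma test_function_deriv: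
  assumes "test_function a \<phi>"
  shows "(\<phi> has_real_derivative deriv \<phi> x) (at x)" "continuous_on A \<phi>" "continuous_on A (deriv \<phi>)"
    "\<phi> 0 = 0" "\<phi> a = 0"
proof -
  have d: "(deriv ^^ n) \<phi> differentiable (at x)" for n x using assms unfolding test_function_def by blast
  show *: "(\<phi> has_real_derivative deriv \<phi> x) (at x)" for x
    using d[of 0 x] by (simp add: DERIV_deriv_iff_real_differentiable)
  show "continuous_on A \<phi>" using * by (meson DERIV_isCont continuous_at_imp_continuous_on)
  show "continuous_on A (deriv \<phi>)"
    using d[of 1] by (auto intro!: continuous_at_imp_continuous_on differentiable_imp_continuous_within)
  show "\<phi> 0 = 0" "\<phi> a = 0" using assms unfolding test_function_def by auto
qed

lemma set_integrable_continuous_Ioo: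
  fixes u :: "real \<Rightarrow> real"
  assumes "continuous_on {0..a} u" shows "set_integrable lborel {0<..<a} u"
  by (rule set_integrable_subset[OF borel_integrable_atLeastAtMost'[OF assms]]) auto

lemma square_integrable_continuous:
  assumes "continuous_on {0..a} u" shows "square_integrable a u"
  unfolding square_integrable_def
proof
  show "set_integrable lborel {0<..<a} (\<lambda>t. (u t)\<^sup>2)"
    by (intro set_integrable_continuous_Ioo continuous_intros assms)
  show "set_borel_measurable lborel {0<..<a} u"
    using set_integrable_continuous_Ioo[OF assms]
    by (simp add: set_integrable_def set_borel_measurable_def borel_measurable_integrable)
qed

lemma square_integrable_mult:
  assumes "square_integrable a u" "square_integrable a v"
  shows "set_integrable lborel {0<..<a} (\<lambda>t. u t * v t)"
  unfolding set_integrable_def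
proof (rule Bochner_Integration.integrable_bound)
  let ?I = "indicator {0<..<a} :: real \<Rightarrow> real"
  have [measurable]: "(\<lambda>t. ?I t *\<^sub>R u t) \<in> borel_measurable lborel" "(\<lambda>t. ?I t *\<^sub>R v t) \<in> borel_measurable lborel"
    using assms by (auto simp: square_integrable_def set_borel_measurable_def)
  show "integrable lborel (\<lambda>t. ?I t *\<^sub>R (u t)\<^sup>2 + ?I t *\<^sub>R (v t)\<^sup>2)"
    using assms by (auto simp: square_integrable_def set_integrable_def)
  have "(\<lambda>t. (?I t *\<^sub>R u t) * (?I t *\<^sub>R v t)) \<in> borel_measurable lborel" by measurable
  then show "(\<lambda>t. ?I t *\<^sub>R (u t * v t)) \<in> borel_measurable lborel"
    by (rule measurable_cong[THEN iffD1, rotated]) (auto simp: indicator_def)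
  have "\<bar>x * y\<bar> \<le> x\<^sup>2 + y\<^sup>2" for x y :: real
    using sum_squares_bound[of "\<bar>x\<bar>" "\<bar>y\<bar>"] abs_ge_zero[of "x*y"] unfolding abs_mult power2_abs by linarith
  then show "AE t in lborel. norm (?I t *\<^sub>R (u t * v t)) \<le> norm (?I t *\<^sub>R (u t)\<^sup>2 + ?I t *\<^sub>R (v t)\<^sup>2)"
    by (intro AE_I2) (auto simp: indicator_def)
qed

lemma square_integrable_imp_set_integrable:
  assumes "square_integrable a u" shows "set_integrable lborel {0<..<a} u"
  using square_integrable_mult[OF assms square_integrable_continuous[of a "\<lambda>_. 1"]] by simp

lemma square_integrable_linear:
  assumes "square_integrable a u" "square_integrable a v"
  shows "square_integrable a (\<lambda>t. c * u t + d * v t)"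
proof -
  let ?I = "{0<..<a}"
  have i: "set_integrable lborel ?I u" "set_integrable lborel ?I v"
    using assms square_integrable_imp_set_integrable by auto
  have "set_integrable lborel ?I (\<lambda>t. c * u t + d * v t)"
    by (intro set_integral_add set_integrable_mult_right i)
  moreover have "set_integrable lborel ?I (\<lambda>t. c\<^sup>2 * (u t * u t) + (2 * c * d * (u t * v t) + d\<^sup>2 * (v t * v t)))"
    by (intro set_integral_add set_integrable_mult_right square_integrable_mult assms)
  ultimately show ?thesis
    by (auto simp: square_integrable_def set_integrable_def set_borel_measurable_def
       borel_measurable_integrable power2_eq_square algebra_simps)
qed

lemma LINT_continuous_Ioo:
  fixes u :: "real \<Rightarrow> real"
  assumes "continuous_on {0..a} u"
  shows "(LINT t:{0<..<a}|lborel. u t) = integral {0..a} u"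
  using set_borel_integral_eq_integral(2)[OF set_integrable_continuous_Ioo[OF assms]]
  by (simp add: integral_open_interval_real)

text \<open>The derivatives of \<open>\<Theta> (N (x - s))\<close> form an approximate identity at \<open>s\<close>, supported to its right.\<close>

lemma approximate_identity:
  assumes T: "smooth \<Theta>" "mono \<Theta>" "\<And>x. x \<le> 0 \<Longrightarrow> \<Theta> x = 0" "\<And>x. 1 \<le> x \<Longrightarrow> \<Theta> x = 1"
    and u: "continuous_on {0..a} u" and s: "0 < s" "s < a"
    and N: "filterlim N at_top sequentially"
  shows "(\<lambda>n. integral {0..a} (\<lambda>x. u x * (N n * deriv \<Theta> (N n * (x - s))))) \<longlonglongrightarrow> u s"
proof (rule LIMSEQ_I)
  fix \<epsilon> :: real assume "\<epsilon> > 0"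
  obtain \<delta> where \<delta>: "\<delta> > 0" "\<And>x. x \<in> {0..a} \<Longrightarrow> \<bar>x - s\<bar> < \<delta> \<Longrightarrow> \<bar>u x - u s\<bar> < \<epsilon> / 2"
    using u s \<open>\<epsilon> > 0\<close> unfolding continuous_on_iff dist_real_def
    by (metis atLeastAtMost_iff half_gt_zero less_eq_real_def)
  \<comment> \<open>The kernel lives on \<open>[s, s + 1 / N n]\<close>. The first bound puts this
    interval within \<delta> of \<open>s\<close>; the second keeps it inside \<open>[0, a]\<close>,
    so that the kernel has mass 1.\<close>
  have "\<forall>\<^sub>F n in sequentially. N n > max (1 / \<delta>) (1 / (a - s))"
    using N unfolding filterlim_at_top_dense by blast
  then obtain n0 where n0: "\<And>n. n \<ge> n0 \<Longrightarrow> N n > max (1 / \<delta>) (1 / (a - s))"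
    by (auto simp: eventually_sequentially)
  have nn: "deriv \<Theta> x \<ge> 0" for x
    using T(2) smooth_imp_deriv(1)[OF T(1)] by (intro mono_on_imp_deriv_nonneg[of UNIV \<Theta> _ x]) auto
  have z: "deriv \<Theta> x = 0" if "x < 0 \<or> x > 1" for x
  proof (rule DERIV_imp_deriv)
    show "(\<Theta> has_real_derivative 0) (at x)"
    proof (cases "x < 0")
      case True
      have "((\<lambda>_. 0) has_real_derivative 0) (at x)" by simp
      then show ?thesis
        by (rule has_field_derivative_transform_within_open[of _ _ _ "{..<0}"]) (use True T in auto)
    next
      case False
      have "((\<lambda>_. 1) has_real_derivative 0) (at x)" by simp
      then show ?thesis
        by (rule has_field_derivative_transform_within_open[of _ _ _ "{1<..}"]) (use False that T in auto)
    qed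
  qed
  have "norm (integral {0..a} (\<lambda>x. u x * (N n * deriv \<Theta> (N n * (x - s)))) - u s) < \<epsilon>" if "n \<ge> n0" for n
  proof -
    define M where "M = N n"
    define k where "k x = M * deriv \<Theta> (M * (x - s))" for x
    have M: "M > 1 / \<delta>" "M > 1 / (a - s)" using n0[OF that] by (auto simp: M_def)
    then have M0: "M > 0" using \<delta>(1) by (smt (verit) divide_pos_pos)
    have M1: "M * \<delta> > 1" "M * (a - s) > 1" using M \<delta>(1) s by (auto simp: divide_simps)
    have kc: "continuous_on A k" for A unfolding k_def
      by (intro continuous_intros continuous_on_compose2[OF smooth_imp_deriv(3)[OF T(1), of UNIV]]) auto
    have k0: "k x \<ge> 0" for x using M0 nn by (simp add: k_def)
    have "(k has_integral (\<Theta> (M * (a - s)) - \<Theta> (M * (0 - s)))) {0..a}" unfolding k_def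
      using s has_field_derivative_at_within[OF DERIV_smooth_affine[OF T(1)]]
      by (intro fundamental_theorem_of_calculus) (simp_all add: has_real_derivative_iff_has_vector_derivative)
    then have ki: "(k has_integral 1) {0..a}"
      using M1 M0 s T by (simp add: mult_nonneg_nonpos)
    have ui: "(\<lambda>x. u x * k x) integrable_on {0..a}"
      by (intro integrable_continuous_interval continuous_intros u kc)
    have usi: "(\<lambda>x. u s * k x) integrable_on {0..a}"
      by (intro integrable_continuous_interval continuous_intros kc)
    have "integral {0..a} (\<lambda>x. (u x - u s) * k x) = integral {0..a} (\<lambda>x. u x * k x) - integral {0..a} (\<lambda>x. u s * k x)"
      using integral_diff[OF ui usi] by (simp add: left_diff_distrib)
    also have "integral {0..a} (\<lambda>x. u s * k x) = u s"
      using has_integral_mult_right[OF ki, of "u s"] by (simp add: has_integral_iff)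
    finally have "\<bar>integral {0..a} (\<lambda>x. u x * k x) - u s\<bar> = norm (integral {0..a} (\<lambda>x. (u x - u s) * k x))" by simp
    also have "\<dots> \<le> integral {0..a} (\<lambda>x. \<epsilon> / 2 * k x)"
    proof (rule integral_norm_bound_integral)
      show "(\<lambda>x. (u x - u s) * k x) integrable_on {0..a}"
        by (intro integrable_continuous_interval continuous_intros u kc)
      show "(\<lambda>x. \<epsilon> / 2 * k x) integrable_on {0..a}"
        by (intro integrable_continuous_interval continuous_intros kc)
      fix x assume x: "x \<in> {0..a}"
      show "norm ((u x - u s) * k x) \<le> \<epsilon> / 2 * k x"
      proof (cases "M * (x - s) < 0 \<or> M * (x - s) > 1")
        case True then show ?thesis using z by (simp add: k_def)
      next
        case False
        then have "x \<ge> s" using M0 by (simp add: mult_less_0_iff)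
        moreover have "x - s < \<delta>" using False M1(1) M0 by (smt (verit) mult_le_cancel_left_pos)
        ultimately have "\<bar>u x - u s\<bar> < \<epsilon> / 2" using \<delta>(2)[OF x] by auto
        then have "\<bar>u x - u s\<bar> * k x \<le> \<epsilon> / 2 * k x" using k0[of x] by (intro mult_right_mono) auto
        then show ?thesis using k0[of x] by (simp add: abs_mult)
      qed
    qed
    also have "\<dots> = \<epsilon> / 2" using has_integral_mult_right[OF ki, of "\<epsilon> / 2"] by (simp add: has_integral_iff)
    also have "\<dots> < \<epsilon>" using \<open>\<epsilon> > 0\<close> by simp
    finally show ?thesis by (simp add: k_def M_def)
  qed
  then show "\<exists>no. \<forall>n\<ge>no. norm (integral {0..a} (\<lambda>x. u x * (N n * deriv \<Theta> (N n * (x - s)))) - u s) < \<epsilon>"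
    by blast
qed

text \<open>The weak derivative is tested with smoothed indicators of \<open>{s<..t}\<close>,
  differences of two steps. One side of the defining identity tends to \<open>u t - u s\<close> by
  the approximate identity, the other to the integral of \<open>g\<close> by dominated
  convergence.\<close>

lemma weak_deriv_increment_interior:
  assumes u: "continuous_on {0..a} u" and g: "is_weak_deriv a u g" and st: "0 < s" "s \<le> t" "t < a"
  shows "(LINT x:{s<..t}|lborel. g x) = u t - u s"
proof -
  obtain \<Theta> where T: "smooth \<Theta>" "mono \<Theta>" "\<And>x. x \<le> 0 \<Longrightarrow> \<Theta> x = 0" "\<And>x. 1 \<le> x \<Longrightarrow> \<Theta> x = (1::real)"
    using smooth_step_exists by blast
  \<comment> \<open>The summand \<open>2 / (a - t)\<close> makes the ramp that starts at
    \<open>t\<close> end before \<open>a\<close>, so the support stays in a compact part of the open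
    interval.\<close>
  define N where "N n = real n + 2 / (a - t)" for n
  have N: "filterlim N at_top sequentially" unfolding N_def
    by (rule filterlim_at_top_mono[OF filterlim_real_sequentially]) (use st in auto)
  have N0: "N n > 0" "N n * (a - t) > 1" for n
  proof -
    show "N n > 0" using st by (simp add: N_def add_nonneg_pos)
    have "N n * (a - t) = real n * (a - t) + 2" using st by (simp add: N_def field_simps)
    moreover have "real n * (a - t) \<ge> 0" using st by simp
    ultimately show "N n * (a - t) > 1" by linarith
  qed
  define \<phi> where "\<phi> n x = \<Theta> (N n * (x - s)) - \<Theta> (N n * (x - t))" for n x
  have sm: "smooth (\<phi> n)" for n
  proof -
    have "smooth (\<lambda>x. \<Theta> (N n * x + - N n * s) - \<Theta> (N n * x + - N n * t))"
      by (intro smooth_diff smooth_affine T)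
    then show ?thesis by (simp add: \<phi>_def[abs_def] algebra_simps)
  qed
  have d\<phi>: "deriv (\<phi> n) x = N n * deriv \<Theta> (N n * (x - s)) - N n * deriv \<Theta> (N n * (x - t))" for n x
    unfolding \<phi>_def
    by (rule DERIV_imp_deriv) (intro DERIV_diff DERIV_smooth_affine T)
  have \<Theta>0: "0 \<le> \<Theta> x" "\<Theta> x \<le> 1" for x
    using T(3)[of "min x 0"] T(4)[of "max x 1"] monoD[OF T(2), of "min x 0" x] monoD[OF T(2), of x "max x 1"] by auto
  have \<phi>1: "\<bar>\<phi> n x\<bar> \<le> 1" for n x using \<Theta>0[of "N n * (x - s)"] \<Theta>0[of "N n * (x - t)"] by (auto simp: \<phi>_def)
  have test: "test_function a (\<phi> n)" for n
    unfolding test_function_def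
  proof (rule conjI; (intro allI)?, (rule exI[of _ s], rule exI[of _ "t + 1 / N n"], intro conjI allI impI)?)
    show "(deriv ^^ m) (\<phi> n) differentiable at x" for m x using smooth_higher_deriv[OF sm] .
    show "t + 1 / N n < a" using N0[of n] by (simp add: field_simps)
    show "\<phi> n x = 0" if "x \<notin> {s..t + 1 / N n}" for x
    proof (cases "x < s")
      case True
      then have "N n * (x - s) \<le> 0" "N n * (x - t) \<le> 0" using N0[of n] st by (auto simp: mult_le_0_iff)
      then show ?thesis by (simp add: \<phi>_def T(3))
    next
      case False
      then have "x > t + 1 / N n" using that by auto
      then have "1 \<le> N n * (x - t)" using N0[of n] by (simp add: field_simps)
      moreover have "N n * (x - t) \<le> N n * (x - s)" using N0[of n] st by (intro mult_left_mono) auto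
      ultimately show ?thesis by (simp add: \<phi>_def T(4))
    qed
  qed (use st in auto)
  have \<Theta>c: "continuous_on {0..a} (\<lambda>x. u x * (N n * deriv \<Theta> (N n * (x - r))))" for n r
    by (intro continuous_intros u continuous_on_compose2[OF smooth_imp_deriv(3)[OF T(1), of UNIV]]) auto
  have "(LINT x:{0<..<a}|lborel. u x * deriv (\<phi> n) x) =
     integral {0..a} (\<lambda>x. u x * (N n * deriv \<Theta> (N n * (x - s)))) -
     integral {0..a} (\<lambda>x. u x * (N n * deriv \<Theta> (N n * (x - t))))" for n
  proof -
    have "(LINT x:{0<..<a}|lborel. u x * deriv (\<phi> n) x) = integral {0..a} (\<lambda>x. u x * deriv (\<phi> n) x)"
      by (intro LINT_continuous_Ioo continuous_intros u smooth_imp_deriv sm)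
    also have "\<dots> = integral {0..a} (\<lambda>x. u x * (N n * deriv \<Theta> (N n * (x - s))) - u x * (N n * deriv \<Theta> (N n * (x - t))))"
      by (simp add: d\<phi> algebra_simps)
    finally show ?thesis by (simp add: integral_diff integrable_continuous_interval \<Theta>c)
  qed
  then have "(\<lambda>n. LINT x:{0<..<a}|lborel. u x * deriv (\<phi> n) x) \<longlonglongrightarrow> u s - u t"
    using tendsto_diff[OF approximate_identity[OF T u _ _ N, of s] approximate_identity[OF T u _ _ N, of t]] st
    by simp
  then have "(\<lambda>n. - (LINT x:{0<..<a}|lborel. u x * deriv (\<phi> n) x)) \<longlonglongrightarrow> - (u s - u t)"
    by (rule tendsto_minus)
  then have 1: "(\<lambda>n. LINT x:{0<..<a}|lborel. g x * \<phi> n x) \<longlonglongrightarrow> u t - u s"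
    using g test unfolding is_weak_deriv_def by simp
  have sq: "square_integrable a g" using g by (simp add: is_weak_deriv_def)
  have gi: "integrable lborel (\<lambda>x. indicator {0<..<a} x * g x)"
    using square_integrable_imp_set_integrable[OF sq] by (simp add: set_integrable_def)
  have 2: "(\<lambda>n. LINT x:{0<..<a}|lborel. g x * \<phi> n x) \<longlonglongrightarrow> (LINT x:{s<..t}|lborel. g x)"
    unfolding set_lebesgue_integral_def
  proof (rule integral_dominated_convergence)
    show "integrable lborel (\<lambda>x. norm (indicator {0<..<a} x * g x))" using gi by (rule integrable_norm)
    have "set_integrable lborel {s<..t} g"
      by (rule set_integrable_subset[OF square_integrable_imp_set_integrable[OF sq]]) (use st in auto)
    then show "(\<lambda>x. indicator {s<..t} x *\<^sub>R g x) \<in> borel_measurable lborel"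
      by (simp add: set_integrable_def borel_measurable_integrable)
    have "set_integrable lborel {0<..<a} (\<lambda>x. g x * \<phi> n x)" for n
      by (intro square_integrable_mult sq square_integrable_continuous smooth_imp_deriv sm)
    then show "(\<lambda>x. indicator {0<..<a} x *\<^sub>R (g x * \<phi> n x)) \<in> borel_measurable lborel" for n
      by (simp add: set_integrable_def borel_measurable_integrable)
    show "AE x in lborel. norm (indicator {0<..<a} x *\<^sub>R (g x * \<phi> n x)) \<le> norm (indicator {0<..<a} x * g x)" for n
      using \<phi>1[of n] by (auto simp: indicator_def abs_mult mult_left_le intro!: AE_I2)
    have ev1: "\<forall>\<^sub>F n in sequentially. \<Theta> (N n * (x - r)) = 1" if "x > r" for x r
    proof -
      have "\<forall>\<^sub>F n in sequentially. N n \<ge> 1 / (x - r)" using N by (simp add: filterlim_at_top)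
      then show ?thesis
        by eventually_elim (use that in \<open>auto intro!: T(4) simp: field_simps\<close>)
    qed
    \<comment> \<open>\<Theta> is 0 at 0 itself, so the limit is 0 at \<open>s\<close> and 1 at
      \<open>t\<close>; hence the half-open interval.\<close>
    have ev0: "\<Theta> (N n * (x - r)) = 0" if "x \<le> r" for x r n
      using that N0[of n] by (intro T(3)) (simp add: mult_le_0_iff)
    show "AE x in lborel. (\<lambda>n. indicator {0<..<a} x *\<^sub>R (g x * \<phi> n x)) \<longlonglongrightarrow> indicator {s<..t} x *\<^sub>R g x"
    proof (rule AE_I2)
      fix x
      consider "x \<le> s" | "s < x" "x \<le> t" | "x > t" by linarith
      then have "\<forall>\<^sub>F n in sequentially. \<phi> n x = indicator {s<..t} x"
      proof cases
        case 1 then show ?thesis using ev0 st by (auto simp: \<phi>_def)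
      next
        case 2 then show ?thesis using ev1[of s x] ev0[of x t] by (auto simp: \<phi>_def)
      next
        case 3
        then have "x > s" using st by simp
        from ev1[OF this] ev1[OF 3] show ?thesis by eventually_elim (use 3 in \<open>simp add: \<phi>_def\<close>)
      qed
      then have "\<forall>\<^sub>F n in sequentially. indicator {0<..<a} x *\<^sub>R (g x * \<phi> n x) = indicator {s<..t} x *\<^sub>R g x"
        by eventually_elim (use st in \<open>auto simp: indicator_def\<close>)
      then show "(\<lambda>n. indicator {0<..<a} x *\<^sub>R (g x * \<phi> n x)) \<longlonglongrightarrow> indicator {s<..t} x *\<^sub>R g x"
        by (rule tendsto_eventually)
    qed
  qed
  show ?thesis using LIMSEQ_unique[OF 2 1] .
qed

lemma weak_deriv_integrable_on:
  assumes "is_weak_deriv a u g" "0 \<le> s" "t \<le> a"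
  shows "g integrable_on {s..t}" "(\<lambda>x. \<bar>g x\<bar>) integrable_on {s..t}" "(\<lambda>x. (g x)\<^sup>2) integrable_on {s..t}"
proof -
  have sq: "square_integrable a g" using assms(1) by (simp add: is_weak_deriv_def)
  have *: "f integrable_on {s..t}" if "set_integrable lborel {0<..<a} f" for f :: "real \<Rightarrow> real"
  proof -
    have "f integrable_on {0..a}"
      using set_borel_integral_eq_integral(1)[OF that] by (simp add: integrable_on_Icc_iff_Ioo)
    then show ?thesis by (rule integrable_on_subinterval) (use assms in auto)
  qed
  show "g integrable_on {s..t}" "(\<lambda>x. \<bar>g x\<bar>) integrable_on {s..t}" "(\<lambda>x. (g x)\<^sup>2) integrable_on {s..t}"
    using sq square_integrable_imp_set_integrable[OF sq]
    by (auto intro!: * set_integrable_abs simp: square_integrable_def)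
qed

text \<open>On the open interval \<open>u\<close> and the indefinite integral of \<open>g\<close>
  differ by a constant; both are continuous on the closed interval, which carries the formula to the
  end points.\<close>

lemma weak_deriv_increment:
  assumes u: "continuous_on {0..a} u" and g: "is_weak_deriv a u g" and st: "0 \<le> s" "s \<le> t" "t \<le> a" and "0 < a"
  shows "(g has_integral (u t - u s)) {s..t}"
proof -
  have gi: "g integrable_on {0..a}" using weak_deriv_integrable_on[OF g] by simp
  define V where "V x = integral {0..x} g" for x
  have V: "V y - V x = integral {x..y} g" if "0 \<le> x" "x \<le> y" "y \<le> a" for x y
  proof -
    have "g integrable_on {0..y}" using weak_deriv_integrable_on[OF g] that by simp
    from Henstock_Kurzweil_Integration.integral_combine[OF _ _ this, of x] that
    show ?thesis by (simp add: V_def)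
  qed
  have c: "continuous_on {0..a} (\<lambda>x. u x - V x)"
    unfolding V_def by (intro continuous_intros u indefinite_integral_continuous_1 gi)
  have sq: "square_integrable a g" using g by (simp add: is_weak_deriv_def)
  have inner: "u y - u x = V y - V x" if "0 < x" "x \<le> y" "y < a" for x y
  proof -
    have "set_integrable lborel {x<..y} g"
      by (rule set_integrable_subset[OF square_integrable_imp_set_integrable[OF sq]]) (use that in auto)
    then have "(LINT z:{x<..y}|lborel. g z) = integral {x<..y} g"
      by (rule set_borel_integral_eq_integral)
    also have "\<dots> = integral {x..y} g" by (rule integral_subset_negligible) (auto intro: negligible_subset[of "{x}"])
    finally show ?thesis using weak_deriv_increment_interior[OF u g that] V[of x y] that by simp
  qed
  define c where "c = u (a/2) - V (a/2)"
  have "u x - V x = c" if "x \<in> {0<..<a}" for x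
    using inner[of x "a/2"] inner[of "a/2" x] that by (cases "x \<le> a/2") (auto simp: c_def)
  then have "u x - V x = c" if "x \<in> {0..a}" for x
    using continuous_constant_on_closure[of "{0<..<a}" "\<lambda>x. u x - V x" c x] c that \<open>0 < a\<close> by auto
  from this[of s] this[of t] have "u t - u s = V t - V s" using st by auto
  then show ?thesis using V[OF st] weak_deriv_integrable_on[OF g st(1,3)] by (simp add: has_integral_iff)
qed

text \<open>\<open>ennreal\<close> truncates at 0, so \<open>?p\<close> and \<open>?m\<close> are
  the positive and negative parts of \<open>d\<close>. As densities they give measures that agree on
  all half-lines and hence are equal, so the two parts agree almost everywhere; they are never
  positive at the same point.\<close>

lemma AE_eq_0_of_tail_integrals:
  fixes d :: "real \<Rightarrow> real"
  assumes d: "integrable lborel d" and 0: "\<And>x. (LINT t:{x<..}|lborel. d t) = 0"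
  shows "AE t in lborel. d t = 0"
proof -
  have [measurable]: "d \<in> borel_measurable lborel" using d by auto
  let ?p = "\<lambda>t. ennreal (d t)" and ?m = "\<lambda>t. ennreal (- d t)"
  have e: "emeasure (density lborel (\<lambda>t. ennreal (f t))) {x<..} = ennreal (LINT t|lborel. indicator {x<..} t * max 0 (f t))"
    if f: "integrable lborel f" for f :: "real \<Rightarrow> real" and x
  proof -
    have [measurable]: "f \<in> borel_measurable lborel" using f by auto
    have i: "integrable lborel (\<lambda>t. indicator {x<..} t * max 0 (f t))"
      using integrable_mult_indicator[of "{x<..}" lborel "\<lambda>t. max 0 (f t)"] f by simp
    have "emeasure (density lborel (\<lambda>t. ennreal (f t))) {x<..} = (\<integral>\<^sup>+t. ennreal (f t) * indicator {x<..} t \<partial>lborel)"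
      by (simp add: emeasure_density)
    also have "\<dots> = (\<integral>\<^sup>+t. ennreal (indicator {x<..} t * max 0 (f t)) \<partial>lborel)"
      by (intro nn_integral_cong) (auto simp: indicator_def max_def ennreal_neg)
    also have "\<dots> = ennreal (LINT t|lborel. indicator {x<..} t * max 0 (f t))"
      by (intro nn_integral_eq_integral i) auto
    finally show ?thesis .
  qed
  have "density lborel ?p = density lborel ?m"
  proof (rule measure_eqI_lessThan)
    fix x
    have i: "integrable lborel (\<lambda>t. indicator {x<..} t * max 0 (d t))" "integrable lborel (\<lambda>t. indicator {x<..} t * max 0 (- d t))"
      using integrable_mult_indicator[of "{x<..}" lborel "\<lambda>t. max 0 (d t)"]
        integrable_mult_indicator[of "{x<..}" lborel "\<lambda>t. max 0 (- d t)"] d by simp_all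
    have "(LINT t|lborel. indicator {x<..} t * max 0 (d t)) - (LINT t|lborel. indicator {x<..} t * max 0 (- d t))
       = (LINT t:{x<..}|lborel. d t)"
      unfolding set_lebesgue_integral_def
      by (subst Bochner_Integration.integral_diff[OF i, symmetric]) (auto intro!: Bochner_Integration.integral_cong simp: indicator_def)
    then show "emeasure (density lborel ?p) {x<..} = emeasure (density lborel ?m) {x<..}"
      using e[of d x] e[of "\<lambda>t. - d t" x] d 0[of x] by simp
    show "emeasure (density lborel ?p) {x<..} < \<infinity>" using e[OF d, of x] by simp
  qed auto
  then have "AE t in lborel. ?p t = ?m t"
    by (intro sigma_finite_measure.density_unique[OF sigma_finite_lborel]) auto
  then show ?thesis
  proof eventually_elim
    case (elim t)
    then show ?case
      by (cases "d t \<ge> 0") (auto simp: ennreal_neg ennreal_eq_0_iff dest: sym)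
  qed
qed

text \<open>Both weak derivatives integrate to the same increments of \<open>u\<close>, so all tail
  integrals of their difference vanish. This frees the energy from the choice made in
  \<open>weak_deriv\<close>.\<close>

lemma weak_deriv_unique:
  assumes u: "continuous_on {0..a} u" and g: "is_weak_deriv a u g1" "is_weak_deriv a u g2" and "0 < a"
  shows "AE t in lborel. t \<in> {0<..<a} \<longrightarrow> g1 t = g2 t"
proof -
  have sq: "square_integrable a g1" "square_integrable a g2" using g by (auto simp: is_weak_deriv_def)
  note i = sq[THEN square_integrable_imp_set_integrable]
  define d where "d t = indicator {0<..<a} t * (g1 t - g2 t)" for t
  have di: "integrable lborel d"
    using set_integral_diff(1)[OF i] by (simp add: set_integrable_def d_def[abs_def])
  have "(LINT t:{x<..}|lborel. d t) = 0" for x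
  proof -
    have "(LINT t:{x<..}|lborel. d t) = (LINT t:{max x 0<..<a}|lborel. g1 t - g2 t)"
      unfolding set_lebesgue_integral_def
      by (intro Bochner_Integration.integral_cong) (auto simp: d_def indicator_def)
    also have "\<dots> = 0"
    proof (cases "max x 0 < a")
      case True
      have j: "set_integrable lborel {max x 0<..<a} g1" "set_integrable lborel {max x 0<..<a} g2"
        by (rule set_integrable_subset[OF i(1)] set_integrable_subset[OF i(2)]; force)+
      have "(LINT t:{max x 0<..<a}|lborel. g t) = u a - u (max x 0)" if "is_weak_deriv a u g"
          "set_integrable lborel {max x 0<..<a} g" for g
        using weak_deriv_increment[OF u that(1), of "max x 0" a] True \<open>0 < a\<close> set_borel_integral_eq_integral(2)[OF that(2)]
        by (simp add: integral_open_interval_real has_integral_iff)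
      then show ?thesis using g j by (simp add: set_integral_diff)
    next
      case False
      then have "{max x 0<..<a} = {}" by auto
      then show ?thesis by (simp only:) (simp add: set_lebesgue_integral_def)
    qed
    finally show ?thesis .
  qed
  from AE_eq_0_of_tail_integrals[OF di this] show ?thesis
    by eventually_elim (auto simp: d_def)
qed

text \<open>Integration by parts: the product with a test function vanishes at both ends. The finite
  set \<open>S\<close> admits kinks, which the tent and distance functions have.\<close>

lemma is_weak_deriv_classical:
  assumes u: "continuous_on {0..a} u" and S: "finite S" and "0 < a"
    and d: "\<And>t. t \<in> {0<..<a} - S \<Longrightarrow> (u has_real_derivative g t) (at t)"
    and g: "g \<in> borel_measurable borel" "\<And>t. \<bar>g t\<bar> \<le> K"
  shows "is_weak_deriv a u g"
proof -
  have gb: "set_integrable lborel {0<..<a} (\<lambda>t. (g t) ^ n)" for n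
    unfolding set_integrable_def
  proof (rule Bochner_Integration.integrable_bound)
    show "integrable lborel (\<lambda>t. indicator {0<..<a} t *\<^sub>R (K ^ n))"
      using \<open>0 < a\<close> by (intro integrable_indicator) auto
    show "(\<lambda>t. indicator {0<..<a} t *\<^sub>R g t ^ n) \<in> borel_measurable lborel" using g(1) by simp
    have "\<bar>g t ^ n\<bar> \<le> \<bar>K ^ n\<bar>" for t using power_mono[OF g(2)[of t], of n] g(2)[of t] by (simp add: power_abs)
    then show "AE t in lborel. norm (indicator {0<..<a} t *\<^sub>R g t ^ n) \<le> norm (indicator {0<..<a} t *\<^sub>R (K ^ n))"
      by (intro AE_I2) (auto simp: indicator_def)
  qed
  have sq: "square_integrable a g"
    using gb[of 2] g(1) by (simp add: square_integrable_def set_borel_measurable_def)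
  show ?thesis unfolding is_weak_deriv_def
  proof (intro conjI allI impI sq)
    fix \<phi> assume t: "test_function a \<phi>"
    note T = test_function_deriv[OF t]
    have 1: "set_integrable lborel {0<..<a} (\<lambda>t. u t * deriv \<phi> t)" "set_integrable lborel {0<..<a} (\<lambda>t. g t * \<phi> t)"
      by (intro square_integrable_mult sq square_integrable_continuous T u)+
    have "((\<lambda>t. u t * deriv \<phi> t + g t * \<phi> t) has_integral (u a * \<phi> a - u 0 * \<phi> 0)) {0..a}"
      using S \<open>0 < a\<close>
      by (intro fundamental_theorem_of_calculus_interior_strong[of S] continuous_intros u T)
        (auto intro!: derivative_eq_intros d T simp: has_real_derivative_iff_has_vector_derivative[symmetric])
    then have "((\<lambda>t. u t * deriv \<phi> t + g t * \<phi> t) has_integral 0) {0<..<a}"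
      by (simp add: T has_integral_Icc_iff_Ioo)
    moreover have "(LINT t:{0<..<a}|lborel. u t * deriv \<phi> t + g t * \<phi> t) = integral {0<..<a} (\<lambda>t. u t * deriv \<phi> t + g t * \<phi> t)"
      by (intro set_borel_integral_eq_integral set_integral_add 1)
    ultimately have "(LINT t:{0<..<a}|lborel. u t * deriv \<phi> t + g t * \<phi> t) = 0" by (simp add: has_integral_iff)
    then show "(LINT t:{0<..<a}|lborel. u t * deriv \<phi> t) = - (LINT t:{0<..<a}|lborel. g t * \<phi> t)"
      by (simp add: set_integral_add 1)
  qed
qed

lemma is_weak_deriv_linear:
  assumes u: "continuous_on {0..a} u" "continuous_on {0..a} v" and g: "is_weak_deriv a u g" "is_weak_deriv a v h"
  shows "is_weak_deriv a (\<lambda>t. c * u t + d * v t) (\<lambda>t. c * g t + d * h t)"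
  unfolding is_weak_deriv_def
proof (intro conjI allI impI)
  have sq: "square_integrable a g" "square_integrable a h" using g by (auto simp: is_weak_deriv_def)
  show "square_integrable a (\<lambda>t. c * g t + d * h t)" by (rule square_integrable_linear[OF sq])
  fix \<phi> assume t: "test_function a \<phi>"
  note T = test_function_deriv[OF t]
  have eq: "(LINT t:{0<..<a}|lborel. (c * p t + d * q t) * r t) = c * (LINT t:{0<..<a}|lborel. p t * r t) + d * (LINT t:{0<..<a}|lborel. q t * r t)"
    if "square_integrable a p" "square_integrable a q" "square_integrable a r" for p q r
  proof -
    note i = square_integrable_mult[OF that(1,3)] square_integrable_mult[OF that(2,3)]
    have "(LINT t:{0<..<a}|lborel. (c * p t + d * q t) * r t) = (LINT t:{0<..<a}|lborel. c * (p t * r t) + d * (q t * r t))"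
      by (simp add: algebra_simps)
    also have "\<dots> = (LINT t:{0<..<a}|lborel. c * (p t * r t)) + (LINT t:{0<..<a}|lborel. d * (q t * r t))"
      by (intro set_integral_add set_integrable_mult_right i)
    finally show ?thesis by simp
  qed
  have "(LINT t:{0<..<a}|lborel. u t * deriv \<phi> t) = - (LINT t:{0<..<a}|lborel. g t * \<phi> t)"
    "(LINT t:{0<..<a}|lborel. v t * deriv \<phi> t) = - (LINT t:{0<..<a}|lborel. h t * \<phi> t)"
    using g t by (auto simp: is_weak_deriv_def)
  then show "(LINT t:{0<..<a}|lborel. (c * u t + d * v t) * deriv \<phi> t) = - (LINT t:{0<..<a}|lborel. (c * g t + d * h t) * \<phi> t)"
    by (simp add: eq square_integrable_continuous u T sq)
qed

lemma is_weak_deriv_cong: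
  assumes "\<And>t. t \<in> {0<..<a} \<Longrightarrow> u t = v t" shows "is_weak_deriv a u = is_weak_deriv a v"
proof -
  have "(LINT t:{0<..<a}|lborel. u t * f t) = (LINT t:{0<..<a}|lborel. v t * f t)" for f
    by (intro set_lebesgue_integral_cong) (use assms in auto)
  then show ?thesis by (auto simp: is_weak_deriv_def fun_eq_iff)
qed

lemma is_weak_deriv_abs:
  assumes "0 < a" shows "is_weak_deriv a (\<lambda>t. \<bar>t - b\<bar>) (\<lambda>t. sgn (t - b))"
proof (rule is_weak_deriv_classical[of _ _ "{b}" _ 1])
  show "((\<lambda>t. \<bar>t - b\<bar>) has_real_derivative sgn (t - b)) (at t)" if "t \<in> {0<..<a} - {b}" for t
  proof (cases "t < b")
    case True
    have "((\<lambda>t. b - t) has_real_derivative sgn (t - b)) (at t)"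
      using True by (auto intro!: derivative_eq_intros)
    then show ?thesis
      by (rule has_field_derivative_transform_within_open[of _ _ _ "{..<b}"]) (use True in auto)
  next
    case False
    then have "t > b" using that by auto
    have "((\<lambda>t. t - b) has_real_derivative sgn (t - b)) (at t)"
      using \<open>t > b\<close> by (auto intro!: derivative_eq_intros)
    then show ?thesis
      by (rule has_field_derivative_transform_within_open[of _ _ _ "{b<..}"]) (use \<open>t > b\<close> in auto)
  qed
  show "\<bar>sgn (t - b)\<bar> \<le> 1" for t by (simp add: sgn_if)
qed (use assms in \<open>auto intro!: continuous_intros\<close>)

lemma is_weak_deriv_affine:
  assumes "0 < a" shows "is_weak_deriv a (\<lambda>t. c + d * t) (\<lambda>t. d)"
  by (rule is_weak_deriv_classical[of _ _ "{}" _ "\<bar>d\<bar>"])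
    (use assms in \<open>auto intro!: continuous_intros derivative_eq_intros\<close>)

section \<open>Paths and increments\<close>

lemma gpath_nonneg: "gpath G len x y r \<Longrightarrow> 0 \<le> r"
  by (induction rule: gpath.induct) auto

lemma gpath_trans:
  assumes "gpath G len y z s" "gpath G len x y r" shows "gpath G len x z (r + s)"
  using assms
proof (induction rule: gpath.induct)
  case trivial then show ?case by simp
next
  case (segment e s r' t)
  then show ?case using gpath.segment[of G len x e s "r + r'" t] by (simp add: add.assoc)
qed

context metric_graph
begin

lemma edge_point_simps:
  assumes "e \<in> arcs G"
  shows "edge_point G len e 0 = Vertex (tail G e)" "edge_point G len e (len e) = Vertex (head G e)"
    "0 < t \<Longrightarrow> t < len e \<Longrightarrow> edge_point G len e t = Inner e t"
  using len_pos[OF assms] by (auto simp: edge_point_def)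

lemma edge_point_in_gpoints: "e \<in> arcs G \<Longrightarrow> t \<in> {0..len e} \<Longrightarrow> edge_point G len e t \<in> gpoints G len"
  by (auto simp: edge_point_def gpoints_def)

lemma gpoint_cases:
  assumes "z \<in> gpoints G len"
  obtains (vertex) v where "v \<in> verts G" "z = Vertex v"
    | (inner) e t where "e \<in> arcs G" "0 < t" "t < len e" "z = Inner e t"
  using assms by (auto simp: gpoints_def)

lemma gpath_edge:
  assumes "e \<in> arcs G" "s \<in> {0..len e}" "t \<in> {0..len e}"
  shows "gpath G len (edge_point G len e s) (edge_point G len e t) \<bar>t - s\<bar>"
  using gpath.segment[OF gpath.trivial[OF edge_point_in_gpoints[OF assms(1,2)]] assms] by simp

lemma gpath_vertices_exists:
  assumes "u \<in> verts G" "v \<in> verts G" shows "\<exists>r. gpath G len (Vertex u) (Vertex v) r"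
proof -
  have "u \<rightarrow>\<^sup>*\<^bsub>with_proj (mk_symmetric G)\<^esub> v"
    using graph_connected assms by (auto simp: connected_def strongly_connected_def)
  then have "(u, v) \<in> rtrancl_on (verts G) (parcs (mk_symmetric G))"
    by (simp add: reachable_def)
  then show ?thesis
  proof (induction rule: rtrancl_on_induct)
    case base
    then show ?case using gpath.trivial[of "Vertex u" G len] by (auto simp: gpoints_def)
  next
    case (step y z)
    then obtain r e where r: "gpath G len (Vertex u) (Vertex y) r"
      and e: "e \<in> arcs G" "y = tail G e \<and> z = head G e \<or> y = head G e \<and> z = tail G e"
      by (auto simp: parcs_mk_symmetric)
    have "gpath G len (Vertex y) (Vertex z) (len e)"
      using e gpath_edge[OF e(1), of 0 "len e"] gpath_edge[OF e(1), of "len e" 0] len_pos[OF e(1)]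
      by (auto simp: edge_point_simps[OF e(1)])
    then show ?case using gpath_trans r by blast
  qed
qed

lemma gpath_to_vertex:
  assumes "x \<in> gpoints G len"
  obtains v r where "v \<in> verts G" "r \<le> total_length G len" "gpath G len x (Vertex v) r" "gpath G len (Vertex v) x r"
  using assms
proof (cases rule: gpoint_cases)
  case (vertex v)
  have "0 \<le> total_length G len" unfolding total_length_def by (intro sum_nonneg) (auto simp: len_pos less_imp_le)
  then show ?thesis using that[of v 0] gpath.trivial[OF assms] vertex by auto
next
  case (inner e t)
  have "len e \<le> total_length G len"
    unfolding total_length_def using inner by (intro member_le_sum) (auto simp: len_pos less_imp_le)
  then show ?thesis
    using that[of "tail G e" t] gpath_edge[OF inner(1), of 0 t] gpath_edge[OF inner(1), of t 0] inner
    by (auto simp: edge_point_simps)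
qed

text \<open>The bound is uniform in both points, so the supremum in \<open>gdiam\<close> is taken
  over a bounded set.\<close>

lemma gpath_exists_bounded:
  obtains K where "\<And>x y. x \<in> gpoints G len \<Longrightarrow> y \<in> gpoints G len \<Longrightarrow> \<exists>r\<le>K. gpath G len x y r"
proof -
  obtain d where d: "\<And>u v. u \<in> verts G \<Longrightarrow> v \<in> verts G \<Longrightarrow> gpath G len (Vertex u) (Vertex v) (d u v)"
    using gpath_vertices_exists by metis
  define D where "D = (\<Sum>u\<in>verts G. \<Sum>v\<in>verts G. d u v)"
  have dD: "d u v \<le> D" if "u \<in> verts G" "v \<in> verts G" for u v
  proof -
    have "d u v \<le> (\<Sum>v\<in>verts G. d u v)" using that by (intro member_le_sum) (auto intro: gpath_nonneg[OF d])
    also have "\<dots> \<le> D" unfolding D_def using that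
      by (intro member_le_sum[of u "verts G" "\<lambda>u. \<Sum>v\<in>verts G. d u v"]) (auto intro!: sum_nonneg gpath_nonneg[OF d])
    finally show ?thesis .
  qed
  show ?thesis
  proof (rule that[of "total_length G len + D + total_length G len"])
    fix x y assume "x \<in> gpoints G len" "y \<in> gpoints G len"
    then obtain u r v s where "u \<in> verts G" "r \<le> total_length G len" "gpath G len x (Vertex u) r"
       "v \<in> verts G" "s \<le> total_length G len" "gpath G len (Vertex v) y s"
      by (meson gpath_to_vertex)
    moreover from this have "gpath G len x y (r + d u v + s)"
      using d gpath_trans by meson
    ultimately show "\<exists>r\<le>total_length G len + D + total_length G len. gpath G len x y r"
      using dD[of u v] by (intro exI[of _ "r + d u v + s"]) auto
  qed
qed

section \<open>Distance and diameter\<close>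

lemma gpath_lengths_bdd_below: "bdd_below {r. gpath G len x y r}"
  by (rule bdd_belowI[of _ 0]) (auto dest: gpath_nonneg)

lemma gdist_le: "gpath G len x y r \<Longrightarrow> gdist G len x y \<le> r"
  unfolding gdist_def by (intro cInf_lower gpath_lengths_bdd_below) simp

lemma gpath_exists:
  assumes "x \<in> gpoints G len" "y \<in> gpoints G len" shows "\<exists>r. gpath G len x y r"
  using gpath_exists_bounded assms by metis

lemma gdist_greatest:
  assumes "x \<in> gpoints G len" "y \<in> gpoints G len" "\<And>r. gpath G len x y r \<Longrightarrow> c \<le> r"
  shows "c \<le> gdist G len x y"
  unfolding gdist_def using gpath_exists[OF assms(1,2)] assms(3) by (intro cInf_greatest) auto

lemma gdist_nonneg: "x \<in> gpoints G len \<Longrightarrow> y \<in> gpoints G len \<Longrightarrow> 0 \<le> gdist G len x y"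
  by (intro gdist_greatest gpath_nonneg)

lemma gdist_self: "x \<in> gpoints G len \<Longrightarrow> gdist G len x x = 0"
  using gdist_le[OF gpath.trivial] gdist_nonneg by (metis order_antisym)

lemma gdist_edge_le:
  assumes "x \<in> gpoints G len" "e \<in> arcs G" "s \<in> {0..len e}" "t \<in> {0..len e}"
  shows "gdist G len x (edge_point G len e t) \<le> gdist G len x (edge_point G len e s) + \<bar>t - s\<bar>"
proof -
  have "gdist G len x (edge_point G len e t) - \<bar>t - s\<bar> \<le> gdist G len x (edge_point G len e s)"
  proof (rule gdist_greatest)
    fix r assume "gpath G len x (edge_point G len e s) r"
    then have "gdist G len x (edge_point G len e t) \<le> r + \<bar>t - s\<bar>"
      by (intro gdist_le gpath.segment assms)
    then show "gdist G len x (edge_point G len e t) - \<bar>t - s\<bar> \<le> r" by simp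
  qed (use assms edge_point_in_gpoints in auto)
  then show ?thesis by simp
qed

lemma gdist_le_gdiam:
  assumes "x \<in> gpoints G len" "y \<in> gpoints G len" shows "gdist G len x y \<le> gdiam G len"
proof -
  obtain K where K: "\<And>x y. x \<in> gpoints G len \<Longrightarrow> y \<in> gpoints G len \<Longrightarrow> \<exists>r\<le>K. gpath G len x y r"
    using gpath_exists_bounded by blast
  have "gdist G len x y \<le> K" if "x \<in> gpoints G len" "y \<in> gpoints G len" for x y
    using K[OF that] gdist_le order_trans by meson
  then show ?thesis unfolding gdiam_def using assms by (intro cSup_upper bdd_aboveI[of _ K]) auto
qed

lemma gdiam_approx:
  assumes "c < gdiam G len"
  obtains x y where "x \<in> gpoints G len" "y \<in> gpoints G len" "c < gdist G len x y"
proof -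
  obtain e where "e \<in> arcs G" using arcs_nonempty by blast
  then have "Vertex (tail G e) \<in> gpoints G len" by (auto simp: gpoints_def)
  then have "{gdist G len x y |x y. x \<in> gpoints G len \<and> y \<in> gpoints G len} \<noteq> {}" by blast
  from less_cSupE[OF assms[unfolded gdiam_def] this] show ?thesis using that by blast
qed

section \<open>Functions in \<open>H1\<close> along an edge\<close>

lemma continuous_map_edge_point:
  "e \<in> arcs G \<Longrightarrow> continuous_map (top_of_set {0..len e}) (gtop G len) (edge_point G len e)"
  by (auto simp: continuous_map_def topspace_gtop edge_point_in_gpoints openin_gtop)

lemma H1_continuous_edge:
  assumes "f \<in> H1 G len" "e \<in> arcs G" shows "continuous_on {0..len e} (\<lambda>t. f (edge_point G len e t))"
proof -
  have "continuous_map (top_of_set {0..len e}) euclideanreal (f \<circ> edge_point G len e)"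
    using assms by (intro continuous_map_compose[OF continuous_map_edge_point]) (auto simp: H1_def)
  then show ?thesis by (simp add: comp_def)
qed

lemma H1_weak_deriv:
  assumes "f \<in> H1 G len" "e \<in> arcs G"
  shows "is_weak_deriv (len e) (\<lambda>t. f (edge_point G len e t)) (edge_deriv G len f e)"
  unfolding edge_deriv_def weak_deriv_def
  using assms by (intro someI_ex[of "is_weak_deriv _ _"]) (auto simp: H1_def sobolev_interval_def)

lemma H1_square_integrable:
  assumes "f \<in> H1 G len" "e \<in> arcs G" shows "square_integrable (len e) (edge_deriv G len f e)"
  using H1_weak_deriv[OF assms] by (simp add: is_weak_deriv_def)

end

text \<open>Young's inequality with a free weight is summed over the pieces instead of the
  Cauchy--Schwarz inequality, which is recovered by optimising the weight.\<close>

lemma measure_image_intervals_le: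
  fixes u :: "real \<Rightarrow> real"
  assumes u: "continuous_on {0..a} u" and g: "is_weak_deriv a u g" and "0 < a" "0 < \<delta>"
    and A: "finite A" "\<And>K. K \<in> A \<Longrightarrow> \<exists>s t. K = {s..t} \<and> 0 \<le> s \<and> s \<le> t \<and> t \<le> a"
  shows "measure lebesgue (u ` \<Union>A) \<le> \<delta> / 2 * integral {0..a} (\<lambda>t. (g t)\<^sup>2) + measure lebesgue (\<Union>A) / (2 * \<delta>)"
proof -
  note gi = weak_deriv_integrable_on[OF g]
  have inc: "\<bar>u t - u s\<bar> \<le> integral {c..d} (\<lambda>t. \<bar>g t\<bar>)"
    if "0 \<le> c" "d \<le> a" "s \<in> {c..d}" "t \<in> {c..d}" for s t c d
  proof -
    have "\<bar>u t - u s\<bar> \<le> integral {c..d} (\<lambda>t. \<bar>g t\<bar>)" if "c \<le> s" "s \<le> t" "t \<le> d" for s t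
    proof -
      have st: "0 \<le> s" "t \<le> a" using that \<open>0 \<le> c\<close> \<open>d \<le> a\<close> by auto
      have "u t - u s = integral {s..t} g"
        using weak_deriv_increment[OF u g, of s t] that st \<open>0 < a\<close> by (simp add: has_integral_iff)
      then have "\<bar>u t - u s\<bar> \<le> integral {s..t} (\<lambda>t. \<bar>g t\<bar>)"
        using integral_norm_bound_integral[OF gi(1)[OF st] gi(2)[OF st]] by simp
      also have "\<dots> \<le> integral {c..d} (\<lambda>t. \<bar>g t\<bar>)"
        using that st \<open>0 \<le> c\<close> \<open>d \<le> a\<close> by (intro integral_subset_le gi) auto
      finally show ?thesis .
    qed
    from this[of s t] this[of t s] that show ?thesis by (cases "s \<le> t") (auto simp: abs_minus_commute)
  qed
  have "\<exists>a b. s = cbox a b" if "s \<in> A" for s using A(2)[OF that] by (metis cbox_interval)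
  \<comment> \<open>The intervals of \<open>A\<close> may overlap; a division of their union counts
    every piece once.\<close>
  then obtain p where p: "p division_of \<Union>A" using elementary_unions_intervals[OF A(1)] by blast
  have fp: "finite p" using p by (rule division_of_finite)
  have sub: "\<Union>A \<subseteq> {0..a}" using A(2) by fastforce
  have K: "\<exists>c d. K = {c..d} \<and> c \<le> d \<and> 0 \<le> c \<and> d \<le> a" if Kp: "K \<in> p" for K
  proof -
    obtain c d where cd: "K = {c..d}" using division_ofD(4)[OF p Kp] by (metis cbox_interval)
    moreover have "K \<noteq> {}" "K \<subseteq> {0..a}" using division_ofD(2,3)[OF p Kp] sub by auto
    ultimately show ?thesis by auto
  qed
  have uK: "compact (u ` K)" if "K \<in> p" for K
    using K[OF that] by (auto intro!: compact_continuous_image continuous_on_subset[OF u])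
  then have uKs: "u ` K \<in> sets lebesgue" if "K \<in> p" for K
    using that by (blast intro: lmeasurable_compact fmeasurableD)
  have m: "measure lebesgue (u ` K) \<le> \<delta> / 2 * integral K (\<lambda>t. (g t)\<^sup>2) + measure lebesgue K / (2 * \<delta>)" if Kp: "K \<in> p" for K
  proof -
    obtain c d where cd: "K = {c..d}" "c \<le> d" "0 \<le> c" "d \<le> a" using K[OF Kp] by blast
    have uc: "continuous_on {c..d} u" by (rule continuous_on_subset[OF u]) (use cd in auto)
    obtain s where s: "s \<in> {c..d}" "\<And>x. x \<in> {c..d} \<Longrightarrow> u s \<le> u x"
      using continuous_attains_inf[OF compact_Icc _ uc] cd by auto
    obtain t where t: "t \<in> {c..d}" "\<And>x. x \<in> {c..d} \<Longrightarrow> u x \<le> u t"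
      using continuous_attains_sup[OF compact_Icc _ uc] cd by auto
    have "u ` K \<subseteq> {u s..u t}" using s t cd by auto
    then have "measure lebesgue (u ` K) \<le> measure lebesgue {u s..u t}"
      by (intro measure_mono_fmeasurable) (use uK[OF Kp] in \<open>auto intro: lmeasurable_compact fmeasurableD\<close>)
    also have "\<dots> = u t - u s" using s(2)[OF t(1)] by simp
    also have "\<dots> \<le> integral K (\<lambda>t. \<bar>g t\<bar>)" using inc[OF cd(3,4) s(1) t(1)] cd by simp
    also have "\<dots> \<le> integral K (\<lambda>t. \<delta> / 2 * (g t)\<^sup>2 + 1 / (2 * \<delta>))"
    proof (rule integral_le)
      show "(\<lambda>t. \<bar>g t\<bar>) integrable_on K" using cd gi by simp
      show "(\<lambda>t. \<delta> / 2 * (g t)\<^sup>2 + 1 / (2 * \<delta>)) integrable_on K"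
        using cd gi by (auto intro!: integrable_add integrable_on_mult_right)
      fix t
      have "0 \<le> (\<delta> * \<bar>g t\<bar> - 1)\<^sup>2 / (2 * \<delta>)" using \<open>0 < \<delta>\<close> by simp
      also have "\<dots> = \<delta> / 2 * (g t)\<^sup>2 + 1 / (2 * \<delta>) - \<bar>g t\<bar>"
        using \<open>0 < \<delta>\<close> by (simp add: power2_eq_square field_simps)
      finally show "\<bar>g t\<bar> \<le> \<delta> / 2 * (g t)\<^sup>2 + 1 / (2 * \<delta>)" by simp
    qed
    also have "\<dots> = \<delta> / 2 * integral K (\<lambda>t. (g t)\<^sup>2) + measure lebesgue K / (2 * \<delta>)"
      using cd gi by (subst integral_add) (auto intro!: integrable_on_mult_right)
    finally show ?thesis .
  qed
  have "u ` \<Union>A = (\<Union>K\<in>p. u ` K)" by (simp only: division_ofD(6)[OF p, symmetric] image_Union)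
  then have "measure lebesgue (u ` \<Union>A) \<le> (\<Sum>K\<in>p. measure lebesgue (u ` K))"
    by (simp add: measure_UNION_le[OF fp] uKs)
  also have "\<dots> \<le> (\<Sum>K\<in>p. \<delta> / 2 * integral K (\<lambda>t. (g t)\<^sup>2) + measure lebesgue K / (2 * \<delta>))"
    by (rule sum_mono) (rule m)
  also have "\<dots> = \<delta> / 2 * (\<Sum>K\<in>p. integral K (\<lambda>t. (g t)\<^sup>2)) + (\<Sum>K\<in>p. measure lebesgue K) / (2 * \<delta>)"
    by (simp add: sum.distrib sum_distrib_left sum_divide_distrib)
  finally have 1: "measure lebesgue (u ` \<Union>A) \<le> \<delta> / 2 * (\<Sum>K\<in>p. integral K (\<lambda>t. (g t)\<^sup>2)) + (\<Sum>K\<in>p. measure lebesgue K) / (2 * \<delta>)" .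
  have "((\<lambda>t. (g t)\<^sup>2) has_integral (\<Sum>K\<in>p. integral K (\<lambda>t. (g t)\<^sup>2))) (\<Union>A)"
  proof (rule has_integral_combine_division[OF p])
    fix k assume "k \<in> p"
    then obtain c d where "k = {c..d}" "0 \<le> c" "d \<le> a" using K by blast
    then show "((\<lambda>t. (g t)\<^sup>2) has_integral integral k (\<lambda>t. (g t)\<^sup>2)) k"
      using gi by (simp add: integrable_integral)
  qed
  then have 2: "(\<Sum>K\<in>p. integral K (\<lambda>t. (g t)\<^sup>2)) \<le> integral {0..a} (\<lambda>t. (g t)\<^sup>2)"
    by (rule has_integral_subset_le[OF sub]) (use gi[of 0 a] in auto)
  have "((\<lambda>t. 1) has_integral (\<Sum>K\<in>p. measure lebesgue K)) (\<Union>A)"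
  proof (rule has_integral_combine_division[OF p])
    fix k assume "k \<in> p"
    then obtain c d where "k = {c..d}" "c \<le> d" using K by blast
    then show "((\<lambda>t. 1::real) has_integral measure lebesgue k) k"
      using has_integral_const_real[of "1::real" c d] by simp
  qed
  moreover have "compact (\<Union>A)"
  proof (rule compact_Union[OF A(1)])
    show "compact K" if "K \<in> A" for K using A(2)[OF that] by auto
  qed
  ultimately have 3: "(\<Sum>K\<in>p. measure lebesgue K) = measure lebesgue (\<Union>A)"
    using lmeasure_integral[OF lmeasurable_compact, of "\<Union>A"] by (simp add: integral_unique)
  have "\<delta> / 2 * (\<Sum>K\<in>p. integral K (\<lambda>t. (g t)\<^sup>2)) \<le> \<delta> / 2 * integral {0..a} (\<lambda>t. (g t)\<^sup>2)"
    using 2 \<open>0 < \<delta>\<close> by (intro mult_left_mono) auto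
  then show ?thesis using 1 unfolding 3 by linarith
qed

context metric_graph
begin

text \<open>A path may traverse an edge several times. It is not made simple; the increment along it is bounded
  by the measure of the image of the union of its segments, where each piece counts once.\<close>

definition interval_family :: "('e \<Rightarrow> real set set) \<Rightarrow> bool" where
  "interval_family A \<longleftrightarrow> (\<forall>e\<in>arcs G. finite (A e) \<and>
     (\<forall>K\<in>A e. \<exists>s t. K = {s..t} \<and> 0 \<le> s \<and> s \<le> t \<and> t \<le> len e))"

lemma interval_family_finite: "interval_family A \<Longrightarrow> e \<in> arcs G \<Longrightarrow> finite (A e)"
  and interval_familyD: "interval_family A \<Longrightarrow> e \<in> arcs G \<Longrightarrow> K \<in> A e \<Longrightarrow>
    \<exists>s t. K = {s..t} \<and> 0 \<le> s \<and> s \<le> t \<and> t \<le> len e"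
  by (auto simp: interval_family_def)

lemma compact_interval_family:
  assumes "interval_family A" "e \<in> arcs G" shows "compact (\<Union>(A e))"
proof (rule compact_Union)
  show "compact K" if "K \<in> A e" for K using interval_familyD[OF assms that] by auto
qed (rule interval_family_finite[OF assms])

text \<open>Each segment adds its parameter interval to the family of its edge, which raises the
  total measure by at most the length of the segment; by the intermediate value theorem its image
  covers the values between the two ends. The extra point \<open>f x\<close> serves the trivial
  path, whose family is empty.\<close>

lemma gpath_image_cover:
  assumes f: "f \<in> H1 G len" and "gpath G len x y r"
  shows "\<exists>A. interval_family A \<and> (\<Sum>e\<in>arcs G. measure lebesgue (\<Union>(A e))) \<le> r \<and>
    closed_segment (f x) (f y) \<subseteq> insert (f x) (\<Union>e\<in>arcs G. (\<lambda>t. f (edge_point G len e t)) ` \<Union>(A e))"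
  using assms(2)
proof (induction rule: gpath.induct)
  case trivial
  show ?case by (rule exI[of _ "\<lambda>_. {}"]) (simp add: interval_family_def)
next
  case (segment e s r t)
  then obtain A where A: "interval_family A"
    and m: "(\<Sum>e\<in>arcs G. measure lebesgue (\<Union>(A e))) \<le> r"
    and c: "closed_segment (f x) (f (edge_point G len e s)) \<subseteq> insert (f x) (\<Union>e\<in>arcs G. (\<lambda>t. f (edge_point G len e t)) ` \<Union>(A e))"
    by blast
  define K where "K = {min s t..max s t}"
  define B where "B = A(e := insert K (A e))"
  let ?u = "\<lambda>t. f (edge_point G len e t)"
  have "(\<Sum>e\<in>arcs G. measure lebesgue (\<Union>(B e))) \<le> (\<Sum>e'\<in>arcs G. measure lebesgue (\<Union>(A e')) + (if e = e' then \<bar>t - s\<bar> else 0))"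
  proof (rule sum_mono)
    fix e' assume e': "e' \<in> arcs G"
    show "measure lebesgue (\<Union>(B e')) \<le> measure lebesgue (\<Union>(A e')) + (if e = e' then \<bar>t - s\<bar> else 0)"
    proof (cases "e = e'")
      case True
      have "compact (\<Union>(A e))" using compact_interval_family[OF A \<open>e \<in> arcs G\<close>] .
      then have "measure lebesgue (K \<union> \<Union>(A e)) \<le> measure lebesgue K + measure lebesgue (\<Union>(A e))"
        by (intro measure_Un_le) (auto simp: K_def intro: lmeasurable_compact fmeasurableD)
      moreover have "measure lebesgue K = \<bar>t - s\<bar>" by (simp add: K_def min_def max_def)
      ultimately show ?thesis using True by (simp add: B_def)
    qed (simp add: B_def)
  qed
  also have "\<dots> \<le> r + \<bar>t - s\<bar>"
    using m segment by (simp add: sum.distrib)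
  finally have m': "(\<Sum>e\<in>arcs G. measure lebesgue (\<Union>(B e))) \<le> r + \<bar>t - s\<bar>" .
  have "continuous_on K ?u"
    by (rule continuous_on_subset[OF H1_continuous_edge[OF f \<open>e \<in> arcs G\<close>]]) (use segment in \<open>auto simp: K_def\<close>)
  then have "is_interval (?u ` K)"
    by (auto simp: is_interval_connected_1 K_def intro!: connected_continuous_image)
  moreover have "?u s \<in> ?u ` K" "?u t \<in> ?u ` K" by (auto simp: K_def)
  ultimately have seg: "closed_segment (?u s) (?u t) \<subseteq> ?u ` K"
    by (meson closed_segment_subset is_interval_convex)
  let ?cov = "\<lambda>A. \<Union>e\<in>arcs G. (\<lambda>t. f (edge_point G len e t)) ` \<Union>(A e)"
  have "?cov A \<subseteq> ?cov B" by (intro UN_mono image_mono Union_mono) (auto simp: B_def)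
  then have 1: "closed_segment (f x) (?u s) \<subseteq> insert (f x) (?cov B)"
    by (rule order_trans[OF c insert_mono])
  have "?u ` K \<subseteq> ?u ` \<Union>(B e)" by (intro image_mono) (simp add: B_def)
  also have "\<dots> \<subseteq> ?cov B" by (rule UN_upper[OF \<open>e \<in> arcs G\<close>])
  finally have 2: "closed_segment (?u s) (?u t) \<subseteq> insert (f x) (?cov B)"
    using seg by (meson order_trans subset_insertI)
  have "closed_segment (f x) (?u t) \<subseteq> closed_segment (f x) (?u s) \<union> closed_segment (?u s) (?u t)"
    by (auto simp: closed_segment_eq_real_ivl)
  then have c': "closed_segment (f x) (?u t) \<subseteq> insert (f x) (?cov B)"
    by (rule order_trans[OF _ Un_least[OF 1 2]])
  have K: "\<exists>s t. K = {s..t} \<and> 0 \<le> s \<and> s \<le> t \<and> t \<le> len e"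
    by (rule exI[of _ "min s t"], rule exI[of _ "max s t"]) (use segment in \<open>auto simp: K_def\<close>)
  have "interval_family B" using A K by (simp add: interval_family_def B_def)
  then show ?case using m' c' by blast
qed

lemma LINT_edge:
  assumes "e \<in> arcs G" "square_integrable (len e) g" "square_integrable (len e) h"
  shows "(LINT t:{0<..<len e}|lborel. g t * h t) = integral {0..len e} (\<lambda>t. g t * h t)"
  using set_borel_integral_eq_integral(2)[OF square_integrable_mult[OF assms(2,3)]]
  by (simp add: integral_open_interval_real)

lemma energy_self:
  assumes "f \<in> H1 G len"
  shows "energy G len f f = (\<Sum>e\<in>arcs G. integral {0..len e} (\<lambda>t. (edge_deriv G len f e t)\<^sup>2))"
  unfolding energy_def power2_eq_square
  by (intro sum.cong LINT_edge H1_square_integrable assms) auto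

lemma energy_nonneg:
  assumes "f \<in> H1 G len" shows "0 \<le> energy G len f f"
  unfolding energy_self[OF assms] by (intro sum_nonneg integral_nonneg) (use weak_deriv_integrable_on[OF H1_weak_deriv[OF assms]] in auto)

text \<open>The segment between \<open>f x\<close> and \<open>f y\<close> has the increment as its
  measure, and it is covered by the images of the intervals of the path together with a single
  point.\<close>

lemma gpath_increment_le_weighted:
  assumes f: "f \<in> H1 G len" and p: "gpath G len x y r" and "0 < \<delta>"
  shows "\<bar>f x - f y\<bar> \<le> \<delta> / 2 * energy G len f f + r / (2 * \<delta>)"
proof -
  let ?u = "\<lambda>e t. f (edge_point G len e t)"
  obtain A where A: "interval_family A"
    and m: "(\<Sum>e\<in>arcs G. measure lebesgue (\<Union>(A e))) \<le> r"
    and c: "closed_segment (f x) (f y) \<subseteq> insert (f x) (\<Union>e\<in>arcs G. ?u e ` \<Union>(A e))"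
    using gpath_image_cover[OF f p] by blast
  have comp: "compact (?u e ` \<Union>(A e))" if "e \<in> arcs G" for e
  proof (rule compact_continuous_image)
    show "compact (\<Union>(A e))" using compact_interval_family[OF A that] .
    show "continuous_on (\<Union>(A e)) (?u e)"
      by (rule continuous_on_subset[OF H1_continuous_edge[OF f that]]) (use interval_familyD[OF A that] in fastforce)
  qed
  then have meas: "?u e ` \<Union>(A e) \<in> sets lebesgue" if "e \<in> arcs G" for e
    using that by (blast intro: lmeasurable_compact fmeasurableD)
  have "compact (insert (f x) (\<Union>e\<in>arcs G. ?u e ` \<Union>(A e)))"
    by (intro compact_insert compact_UN comp) auto
  then have "measure lebesgue (closed_segment (f x) (f y)) \<le> measure lebesgue (insert (f x) (\<Union>e\<in>arcs G. ?u e ` \<Union>(A e)))"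
    by (intro measure_mono_fmeasurable c lmeasurable_compact) (auto intro: lmeasurable_compact fmeasurableD)
  also have "insert (f x) (\<Union>e\<in>arcs G. ?u e ` \<Union>(A e)) = {f x} \<union> (\<Union>e\<in>arcs G. ?u e ` \<Union>(A e))" by simp
  also have "measure lebesgue \<dots> \<le> measure lebesgue {f x} + measure lebesgue (\<Union>e\<in>arcs G. ?u e ` \<Union>(A e))"
    by (rule measure_Un_le) (use meas in \<open>auto intro!: sets.finite_UN\<close>)
  also have "measure lebesgue (\<Union>e\<in>arcs G. ?u e ` \<Union>(A e)) \<le> (\<Sum>e\<in>arcs G. measure lebesgue (?u e ` \<Union>(A e)))"
    by (rule measure_UNION_le) (use meas in auto)
  also have "\<dots> \<le> (\<Sum>e\<in>arcs G. \<delta> / 2 * integral {0..len e} (\<lambda>t. (edge_deriv G len f e t)\<^sup>2) + measure lebesgue (\<Union>(A e)) / (2 * \<delta>))"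
    by (intro sum_mono measure_image_intervals_le H1_continuous_edge H1_weak_deriv f len_pos \<open>0 < \<delta>\<close>
      interval_family_finite[OF A] interval_familyD[OF A])
  also have "\<dots> = \<delta> / 2 * energy G len f f + (\<Sum>e\<in>arcs G. measure lebesgue (\<Union>(A e))) / (2 * \<delta>)"
    by (simp add: sum.distrib sum_distrib_left sum_divide_distrib energy_self[OF f])
  also have "\<dots> \<le> \<delta> / 2 * energy G len f f + r / (2 * \<delta>)"
    using m \<open>0 < \<delta>\<close> by (intro add_left_mono divide_right_mono) auto
  finally show ?thesis
    by (auto simp: closed_segment_eq_real_ivl split: if_splits)
qed

lemma gpath_increment_square_le:
  assumes f: "f \<in> H1 G len" and p: "gpath G len x y r"
  shows "(f x - f y)\<^sup>2 \<le> r * energy G len f f"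
proof -
  define d E where "d = \<bar>f x - f y\<bar>" and "E = energy G len f f"
  have E: "E \<ge> 0" using energy_nonneg[OF f] by (simp add: E_def)
  have r: "r \<ge> 0" using gpath_nonneg[OF p] .
  have w: "d \<le> \<delta> / 2 * E + r / (2 * \<delta>)" if "\<delta> > 0" for \<delta>
    using gpath_increment_le_weighted[OF f p that] by (simp add: d_def E_def)
  have "d\<^sup>2 \<le> r * E"
  proof (cases "d = 0")
    case True then show ?thesis using E r by simp
  next
    case False
    then have d: "d > 0" by (simp add: d_def)
    show ?thesis
    proof (cases "r = 0")
      case True
      \<comment> \<open>On a path of length 0 any positive weight leaves only the energy term; this
        one makes that term smaller than \<open>d\<close>, a contradiction.\<close>
      have "d \<le> d / (E + 1) / 2 * E" using w[of "d / (E + 1)"] d E True by simp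
      moreover have "d / (E + 1) / 2 * E < d" proof -
        have "d / (E + 1) / 2 * E = d * (E / (2 * (E + 1)))" by simp
        also have "\<dots> < d * 1" using d E by (intro mult_strict_left_mono) (auto simp: divide_simps)
        finally show ?thesis by simp
      qed
      ultimately show ?thesis by simp
    next
      case False
      \<comment> \<open>This weight turns the second summand into \<open>d / 2\<close>, and it stays
        meaningful when the energy is 0, unlike the minimising weight
        \<open>sqrt (r / E)\<close>.\<close>
      then have "d \<le> r / d / 2 * E + d / 2" using w[of "r / d"] d r by simp
      then show ?thesis using d by (simp add: field_simps power2_eq_square)
    qed
  qed
  then show ?thesis by (simp add: d_def E_def)
qed

lemma increment_square_le_gdist:
  assumes f: "f \<in> H1 G len" and "x \<in> gpoints G len" "y \<in> gpoints G len"
  shows "(f x - f y)\<^sup>2 \<le> gdist G len x y * energy G len f f"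
proof (cases "energy G len f f = 0")
  case True
  then show ?thesis using gpath_exists[OF assms(2,3)] gpath_increment_square_le[OF f] by fastforce
next
  case False
  then have E: "energy G len f f > 0" using energy_nonneg[OF f] by simp
  have "(f x - f y)\<^sup>2 / energy G len f f \<le> gdist G len x y"
    using gpath_increment_square_le[OF f] E by (intro gdist_greatest assms) (simp add: divide_le_eq)
  then show ?thesis using E by (simp add: divide_le_eq)
qed

lemma increment_square_le_gdiam:
  assumes f: "f \<in> H1 G len" and "x \<in> gpoints G len" "y \<in> gpoints G len"
  shows "(f x - f y)\<^sup>2 \<le> gdiam G len * energy G len f f"
  using increment_square_le_gdist[OF assms] mult_right_mono[OF gdist_le_gdiam[OF assms(2,3)] energy_nonneg[OF f]]
  by linarith

lemma energy_zero_imp_const: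
  assumes "f \<in> H1 G len" "energy G len f f = 0" "x \<in> gpoints G len" "y \<in> gpoints G len"
  shows "f x = f y"
  using increment_square_le_gdist[OF assms(1,3,4)] assms(2) by simp

end

section \<open>The energy form\<close>

lemma square_integrable_mult_integrable_on:
  assumes "square_integrable a u" "square_integrable a v"
  shows "(\<lambda>t. u t * v t) integrable_on {0..a}"
  using set_borel_integral_eq_integral(1)[OF square_integrable_mult[OF assms]]
  by (simp add: integrable_on_Icc_iff_Ioo)

context metric_graph
begin

lemma H1_linear:
  assumes f: "f \<in> H1 G len" and g: "g \<in> H1 G len" shows "(\<lambda>x. c * f x + d * g x) \<in> H1 G len"
  unfolding H1_def
proof (intro CollectI conjI ballI)
  show "continuous_map (gtop G len) euclideanreal (\<lambda>x. c * f x + d * g x)"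
    using f g by (intro continuous_intros) (auto simp: H1_def)
  show "\<forall>x. x \<notin> gpoints G len \<longrightarrow> c * f x + d * g x = 0" using f g by (auto simp: H1_def)
  fix e assume e: "e \<in> arcs G"
  show "(\<lambda>t. c * f (edge_point G len e t) + d * g (edge_point G len e t)) \<in> sobolev_interval (len e)"
    using is_weak_deriv_linear[OF H1_continuous_edge[OF f e] H1_continuous_edge[OF g e] H1_weak_deriv[OF f e] H1_weak_deriv[OF g e]]
      square_integrable_linear f g e
    unfolding sobolev_interval_def H1_def by blast
qed

text \<open>By uniqueness almost everywhere any weak derivatives may be inserted, in particular the
  explicit ones of piecewise affine functions.\<close>

lemma energy_eq:
  assumes f: "f \<in> H1 G len" and g: "g \<in> H1 G len"
    and p: "\<And>e. e \<in> arcs G \<Longrightarrow> is_weak_deriv (len e) (\<lambda>t. f (edge_point G len e t)) (p e)"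
    and q: "\<And>e. e \<in> arcs G \<Longrightarrow> is_weak_deriv (len e) (\<lambda>t. g (edge_point G len e t)) (q e)"
  shows "energy G len f g = (\<Sum>e\<in>arcs G. integral {0..len e} (\<lambda>t. p e t * q e t))"
  unfolding energy_def
proof (rule sum.cong[OF refl])
  fix e assume e: "e \<in> arcs G"
  have sq: "square_integrable (len e) (p e)" "square_integrable (len e) (q e)"
    using p[OF e] q[OF e] by (auto simp: is_weak_deriv_def)
  have "AE t in lborel. t \<in> {0<..<len e} \<longrightarrow> edge_deriv G len f e t = p e t"
    by (rule weak_deriv_unique[OF H1_continuous_edge[OF f e] H1_weak_deriv[OF f e] p[OF e] len_pos[OF e]])
  moreover have "AE t in lborel. t \<in> {0<..<len e} \<longrightarrow> edge_deriv G len g e t = q e t"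
    by (rule weak_deriv_unique[OF H1_continuous_edge[OF g e] H1_weak_deriv[OF g e] q[OF e] len_pos[OF e]])
  ultimately have ae: "AE t in lborel. indicator {0<..<len e} t *\<^sub>R (edge_deriv G len f e t * edge_deriv G len g e t)
      = indicator {0<..<len e} t *\<^sub>R (p e t * q e t)"
    by eventually_elim (auto simp: indicator_def)
  have "(LINT t:{0<..<len e}|lborel. edge_deriv G len f e t * edge_deriv G len g e t) = (LINT t:{0<..<len e}|lborel. p e t * q e t)"
    unfolding set_lebesgue_integral_def
    by (rule integral_cong_AE[OF _ _ ae])
      (use square_integrable_mult[OF sq] square_integrable_mult[OF H1_square_integrable[OF f e] H1_square_integrable[OF g e]]
        in \<open>simp_all add: set_integrable_def borel_measurable_integrable\<close>)
  then show "(LINT t:{0<..<len e}|lborel. edge_deriv G len f e t * edge_deriv G len g e t) = integral {0..len e} (\<lambda>t. p e t * q e t)"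
    by (simp add: LINT_edge[OF e sq])
qed

lemma energy_commute: "energy G len f g = energy G len g f"
  unfolding energy_def by (simp add: mult.commute)

lemma energy_linear_left:
  assumes f: "f \<in> H1 G len" and g: "g \<in> H1 G len" and h: "h \<in> H1 G len"
  shows "energy G len (\<lambda>x. c * f x + d * g x) h = c * energy G len f h + d * energy G len g h"
proof -
  let ?f = "edge_deriv G len f" and ?g = "edge_deriv G len g" and ?h = "edge_deriv G len h"
  have "energy G len (\<lambda>x. c * f x + d * g x) h = (\<Sum>e\<in>arcs G. integral {0..len e} (\<lambda>t. (c * ?f e t + d * ?g e t) * ?h e t))"
    by (intro energy_eq H1_linear is_weak_deriv_linear H1_continuous_edge H1_weak_deriv f g h)
  also have "\<dots> = (\<Sum>e\<in>arcs G. c * integral {0..len e} (\<lambda>t. ?f e t * ?h e t) + d * integral {0..len e} (\<lambda>t. ?g e t * ?h e t))"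
  proof (rule sum.cong[OF refl])
    fix e assume e: "e \<in> arcs G"
    have i: "(\<lambda>t. ?f e t * ?h e t) integrable_on {0..len e}" "(\<lambda>t. ?g e t * ?h e t) integrable_on {0..len e}"
      by (intro square_integrable_mult_integrable_on H1_square_integrable f g h e)+
    have "integral {0..len e} (\<lambda>t. (c * ?f e t + d * ?g e t) * ?h e t) = integral {0..len e} (\<lambda>t. c * (?f e t * ?h e t) + d * (?g e t * ?h e t))"
      by (simp add: algebra_simps)
    also have "\<dots> = integral {0..len e} (\<lambda>t. c * (?f e t * ?h e t)) + integral {0..len e} (\<lambda>t. d * (?g e t * ?h e t))"
      by (intro integral_add integrable_on_mult_right i)
    finally show "integral {0..len e} (\<lambda>t. (c * ?f e t + d * ?g e t) * ?h e t)
      = c * integral {0..len e} (\<lambda>t. ?f e t * ?h e t) + d * integral {0..len e} (\<lambda>t. ?g e t * ?h e t)" by simp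
  qed
  also have "\<dots> = c * energy G len f h + d * energy G len g h"
    by (simp add: sum.distrib sum_distrib_left energy_eq[OF f h H1_weak_deriv[OF f] H1_weak_deriv[OF h]]
      energy_eq[OF g h H1_weak_deriv[OF g] H1_weak_deriv[OF h]])
  finally show ?thesis .
qed

lemma energy_linear_right:
  assumes "f \<in> H1 G len" "g \<in> H1 G len" "h \<in> H1 G len"
  shows "energy G len h (\<lambda>x. c * f x + d * g x) = c * energy G len h f + d * energy G len h g"
  using energy_linear_left[OF assms] by (simp add: energy_commute[of h])

lemma edge_deriv_has_integral:
  assumes g: "g \<in> H1 G len" and e: "e \<in> arcs G" and "0 \<le> s" "s \<le> t" "t \<le> len e"
  shows "(edge_deriv G len g e has_integral (g (edge_point G len e t) - g (edge_point G len e s))) {s..t}"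
  using weak_deriv_increment[OF H1_continuous_edge[OF g e] H1_weak_deriv[OF g e]] assms len_pos[OF e] by simp

text \<open>Splitting at \<open>b\<close>, the jump of the sign produces the value of
  \<open>g\<close> at \<open>b\<close> with factor 2 in absolute value. In this way a kink
  represents evaluation at an interior point.\<close>

lemma integral_sgn_edge_deriv:
  assumes g: "g \<in> H1 G len" and e: "e \<in> arcs G" and b: "0 \<le> b" "b \<le> len e"
  shows "((\<lambda>t. sgn (t - b) * edge_deriv G len g e t) has_integral
    (g (Vertex (head G e)) + g (Vertex (tail G e)) - 2 * g (edge_point G len e b))) {0..len e}"
proof -
  note i = edge_deriv_has_integral[OF g e]
  have "((\<lambda>t. sgn (t - b) * edge_deriv G len g e t) has_integral - (g (edge_point G len e b) - g (edge_point G len e 0))) {0..b}"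
    by (rule has_integral_spike_finite[OF _ _ has_integral_neg[OF i[of 0 b]], of "{b}"]) (use b in auto)
  moreover have "((\<lambda>t. sgn (t - b) * edge_deriv G len g e t) has_integral (g (edge_point G len e (len e)) - g (edge_point G len e b))) {b..len e}"
    by (rule has_integral_spike_finite[OF _ _ i[of b "len e"], of "{b}"]) (use b in auto)
  ultimately have "((\<lambda>t. sgn (t - b) * edge_deriv G len g e t) has_integral
     - (g (edge_point G len e b) - g (edge_point G len e 0)) + (g (edge_point G len e (len e)) - g (edge_point G len e b))) {0..len e}"
    using b by (intro has_integral_combine[of 0 b])
  then show ?thesis by (simp add: edge_point_simps[OF e] algebra_simps)
qed

section \<open>Functions on the graph glued from vertex values and edge functions\<close>

definition glue :: "('v \<Rightarrow> real) \<Rightarrow> ('e \<Rightarrow> real \<Rightarrow> real) \<Rightarrow> ('v, 'e) gpoint \<Rightarrow> real" where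
  "glue a u z = (if z \<in> gpoints G len then case z of Vertex v \<Rightarrow> a v | Inner e t \<Rightarrow> u e t else 0)"

lemma glue_edge_point:
  assumes "e \<in> arcs G" "u e 0 = a (tail G e)" "u e (len e) = a (head G e)" "t \<in> {0..len e}"
  shows "glue a u (edge_point G len e t) = u e t"
  using assms edge_point_in_gpoints[OF assms(1,4)] by (auto simp: glue_def edge_point_def)

text \<open>\<open>gtop\<close> is a quotient topology, so continuity is checked edge by edge after
  composition with \<open>edge_point\<close>; the end conditions make the composite equal to
  \<open>u e\<close> on the closed edge.\<close>

lemma glue_H1:
  assumes a: "\<And>e. e \<in> arcs G \<Longrightarrow> u e 0 = a (tail G e)" "\<And>e. e \<in> arcs G \<Longrightarrow> u e (len e) = a (head G e)"
    and u: "\<And>e. e \<in> arcs G \<Longrightarrow> continuous_on {0..len e} (u e)"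
    and p: "\<And>e. e \<in> arcs G \<Longrightarrow> is_weak_deriv (len e) (u e) (p e)"
  shows "glue a u \<in> H1 G len"
    and "\<And>e. e \<in> arcs G \<Longrightarrow> is_weak_deriv (len e) (\<lambda>t. glue a u (edge_point G len e t)) (p e)"
proof -
  have eq: "glue a u (edge_point G len e t) = u e t" if "e \<in> arcs G" "t \<in> {0..len e}" for e t
    using that a by (intro glue_edge_point) auto
  show w: "is_weak_deriv (len e) (\<lambda>t. glue a u (edge_point G len e t)) (p e)" if e: "e \<in> arcs G" for e
    using p[OF e] is_weak_deriv_cong[of "len e" "\<lambda>t. glue a u (edge_point G len e t)" "u e"] eq[OF e] by auto
  have c: "continuous_on {0..len e} (\<lambda>t. glue a u (edge_point G len e t))" if e: "e \<in> arcs G" for e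
    using u[OF e] by (rule continuous_on_eq) (use eq[OF e] in auto)
  show "glue a u \<in> H1 G len" unfolding H1_def
  proof (intro CollectI conjI ballI)
    show "continuous_map (gtop G len) euclideanreal (glue a u)"
      unfolding continuous_map_def topspace_gtop
    proof (intro conjI allI impI)
      fix U :: "real set" assume U: "openin euclideanreal U"
      show "openin (gtop G len) {x \<in> gpoints G len. glue a u x \<in> U}"
        unfolding openin_gtop
      proof (intro conjI ballI)
        fix e assume e: "e \<in> arcs G"
        have "{t \<in> {0..len e}. edge_point G len e t \<in> {x \<in> gpoints G len. glue a u x \<in> U}}
          = {0..len e} \<inter> (\<lambda>t. glue a u (edge_point G len e t)) -` U"
          using edge_point_in_gpoints[OF e] by auto
        then show "openin (top_of_set {0..len e}) {t \<in> {0..len e}. edge_point G len e t \<in> {x \<in> gpoints G len. glue a u x \<in> U}}"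
          using continuous_openin_preimage_gen[OF c[OF e], of U] U by simp
      qed auto
    qed auto
    show "\<forall>x. x \<notin> gpoints G len \<longrightarrow> glue a u x = 0" by (simp add: glue_def)
    fix e assume "e \<in> arcs G"
    then show "(\<lambda>t. glue a u (edge_point G len e t)) \<in> sobolev_interval (len e)"
      unfolding sobolev_interval_def using w c square_integrable_continuous by blast
  qed
qed

definition one :: "('v, 'e) gpoint \<Rightarrow> real" where "one x = of_bool (x \<in> gpoints G len)"

lemma one_H1: "one \<in> H1 G len"
  and energy_one: "g \<in> H1 G len \<Longrightarrow> energy G len one g = 0"
proof -
  have eq: "one = glue (\<lambda>_. 1) (\<lambda>_ _. 1)"
    by (auto simp: one_def glue_def fun_eq_iff split: gpoint.split)
  have w: "is_weak_deriv (len e) (\<lambda>_. 1) (\<lambda>_. 0)" if "e \<in> arcs G" for e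
    using is_weak_deriv_affine[OF len_pos[OF that], of 1 0] by simp
  note 1 = glue_H1[of "\<lambda>_ _. 1" "\<lambda>_. 1" "\<lambda>_ _. 0", folded eq, simplified, OF w]
  show "one \<in> H1 G len" using 1(1) by simp
  show "energy G len one g = 0" if "g \<in> H1 G len"
    using energy_eq[OF 1(1) that 1(2) H1_weak_deriv[OF that]] by simp
qed

text \<open>These are the functionals with a Riesz representer for the energy form. They all vanish
  on constants, which is why differences of point evaluations appear below.\<close>

definition represented :: "((('v, 'e) gpoint \<Rightarrow> real) \<Rightarrow> real) \<Rightarrow> bool" where
  "represented \<phi> \<longleftrightarrow> (\<exists>h\<in>H1 G len. \<forall>g\<in>H1 G len. energy G len h g = \<phi> g)"

lemma represented_linear:
  assumes "represented \<phi>" "represented \<psi>" shows "represented (\<lambda>g. c * \<phi> g + d * \<psi> g)"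
proof -
  obtain h k where "h \<in> H1 G len" "\<forall>g\<in>H1 G len. energy G len h g = \<phi> g"
    "k \<in> H1 G len" "\<forall>g\<in>H1 G len. energy G len k g = \<psi> g"
    using assms unfolding represented_def by blast
  then show ?thesis unfolding represented_def
    by (intro bexI[of _ "\<lambda>x. c * h x + d * k x"] ballI H1_linear) (auto simp: energy_linear_left)
qed

lemma represented_0: "represented (\<lambda>g. 0)"
  unfolding represented_def using one_H1 energy_one by blast

text \<open>The tent with peak at \<open>b\<close> vanishes off the open edge \<open>e\<close>, and
  its slope drops by exactly 1 at \<open>b\<close>, so pairing with it evaluates \<open>g\<close> at
  \<open>b\<close> with coefficient 1. The slopes at the two ends give the weights of the end
  values.\<close>

lemma tent_function:
  assumes e: "e \<in> arcs G" and b: "0 < b" "b < len e"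
  obtains h c where "h \<in> H1 G len" "h (Vertex (tail G e)) = 0" "0 < h (Inner e b)"
    "\<And>g. g \<in> H1 G len \<Longrightarrow>
      energy G len h g = g (Inner e b) - (1 / 2 - c) * g (Vertex (head G e)) - (1 / 2 + c) * g (Vertex (tail G e))"
proof -
  \<comment> \<open>\<open>B\<close> is the slope of the affine part that brings the function back
    to 0 at \<open>len e\<close>.\<close>
  define B where "B = (len e - 2 * b) / (2 * len e)"
  define u where "u e' t = (if e' = e then 1 * (b / 2 + B * t) + (- 1 / 2) * \<bar>t - b\<bar> else 0)" for e' t
  define p where "p e' t = (if e' = e then 1 * B + (- 1 / 2) * sgn (t - b) else 0)" for e' t
  let ?h = "glue (\<lambda>_. 0) u"
  have w: "is_weak_deriv (len e') (u e') (p e')" if "e' \<in> arcs G" for e'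
  proof (cases "e' = e")
    case True
    have "u e = (\<lambda>t. 1 * (b / 2 + B * t) + (- 1 / 2) * \<bar>t - b\<bar>)" "p e = (\<lambda>t. 1 * B + (- 1 / 2) * sgn (t - b))"
      by (auto simp: u_def p_def)
    then show ?thesis unfolding True
      by (simp only:) (intro is_weak_deriv_linear is_weak_deriv_affine is_weak_deriv_abs len_pos e continuous_intros)
  next
    case False
    then have "u e' = (\<lambda>_. 0)" "p e' = (\<lambda>_. 0)" by (auto simp: u_def p_def)
    then show ?thesis using is_weak_deriv_affine[OF len_pos[OF that], of 0 0] by simp
  qed
  have u0: "u e' 0 = 0" for e' using b by (simp add: u_def)
  have u1: "u e' (len e') = 0" if "e' \<in> arcs G" for e' using b by (simp add: u_def B_def field_simps)
  have uc: "continuous_on {0..len e'} (u e')" for e'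
    by (cases "e' = e") (auto simp: u_def[abs_def] intro!: continuous_intros)
  have h: "?h \<in> H1 G len"
    "\<And>e'. e' \<in> arcs G \<Longrightarrow> is_weak_deriv (len e') (\<lambda>t. ?h (edge_point G len e' t)) (p e')"
    by (rule glue_H1[where p = p]; simp add: u0 u1 uc w)+
  have "energy G len ?h g = g (Inner e b) - (1 / 2 - B) * g (Vertex (head G e)) - (1 / 2 + B) * g (Vertex (tail G e))"
    if g: "g \<in> H1 G len" for g
  proof -
    let ?g = "edge_deriv G len g e"
    have "energy G len ?h g = (\<Sum>e'\<in>arcs G. integral {0..len e'} (\<lambda>t. p e' t * edge_deriv G len g e' t))"
      by (rule energy_eq[OF h(1) g h(2) H1_weak_deriv[OF g]])
    also have "\<dots> = (\<Sum>e'\<in>arcs G. if e' = e then integral {0..len e} (\<lambda>t. p e t * ?g t) else 0)"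
      by (rule sum.cong) (auto simp: p_def)
    also have "\<dots> = integral {0..len e} (\<lambda>t. p e t * ?g t)" using e by simp
    also have "(\<lambda>t. p e t * ?g t) = (\<lambda>t. B * ?g t + (- 1 / 2) * (sgn (t - b) * ?g t))"
      by (auto simp: p_def algebra_simps)
    also have "integral {0..len e} \<dots> = B * (g (edge_point G len e (len e)) - g (edge_point G len e 0)) +
       (- 1 / 2) * (g (Vertex (head G e)) + g (Vertex (tail G e)) - 2 * g (edge_point G len e b))"
      using b by (intro integral_unique has_integral_add has_integral_mult_right
          edge_deriv_has_integral[OF g e] integral_sgn_edge_deriv[OF g e]) auto
    finally show ?thesis using b by (simp add: edge_point_simps[OF e] algebra_simps)
  qed
  moreover have "?h (Vertex (tail G e)) = 0" by (simp add: glue_def)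
  moreover have "?h (Inner e b) = b * (len e - b) / len e"
    using e b by (simp add: glue_def gpoints_def u_def B_def field_simps)
  then have "0 < ?h (Inner e b)" using b by simp
  ultimately show ?thesis using h(1) that by blast
qed

lemma represented_inner:
  assumes "e \<in> arcs G" "0 < b" "b < len e"
  shows "\<exists>c. represented (\<lambda>g. g (Inner e b) - (1 / 2 - c) * g (Vertex (head G e)) - (1 / 2 + c) * g (Vertex (tail G e)))"
proof -
  obtain h c where "h \<in> H1 G len" "\<And>g. g \<in> H1 G len \<Longrightarrow>
      energy G len h g = g (Inner e b) - (1 / 2 - c) * g (Vertex (head G e)) - (1 / 2 + c) * g (Vertex (tail G e))"
    using tent_function[OF assms] by blast
  then show ?thesis unfolding represented_def by blast
qed

text \<open>A tent function is not constant, whereas the increment bound with a nonpositive diameter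
  would force equal values at its foot and its peak.\<close>

lemma gdiam_pos: "0 < gdiam G len"
proof (rule ccontr)
  assume "\<not> 0 < gdiam G len"
  obtain e where e: "e \<in> arcs G" using arcs_nonempty by blast
  have b: "0 < len e / 2" "len e / 2 < len e" using len_pos[OF e] by auto
  obtain h where h: "h \<in> H1 G len" "h (Vertex (tail G e)) = 0" "0 < h (Inner e (len e / 2))"
    using tent_function[OF e b] by blast
  have "(h (Inner e (len e / 2)) - h (Vertex (tail G e)))\<^sup>2 \<le> gdiam G len * energy G len h h"
    using e edge_point_in_gpoints[OF e, of "len e / 2"] b unfolding edge_point_simps(3)[OF e b]
    by (intro increment_square_le_gdiam h) (auto simp: gpoints_def)
  also have "\<dots> \<le> 0" using \<open>\<not> 0 < gdiam G len\<close> energy_nonneg[OF h(1)] by (simp add: mult_nonpos_nonneg)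
  finally show False using h by simp
qed

section \<open>The discrete Dirichlet form with conductances \<open>1 / len e\<close>\<close>

definition dirichlet :: "('v \<Rightarrow> real) \<Rightarrow> ('v \<Rightarrow> real) \<Rightarrow> real" where
  "dirichlet a b = (\<Sum>e\<in>arcs G. (a (head G e) - a (tail G e)) * (b (head G e) - b (tail G e)) / len e)"

definition interpolate :: "('v \<Rightarrow> real) \<Rightarrow> ('v, 'e) gpoint \<Rightarrow> real" where
  "interpolate a = glue a (\<lambda>e t. a (tail G e) + (a (head G e) - a (tail G e)) / len e * t)"

text \<open>The derivative is constant on each edge, so pairing it with that of \<open>g\<close>
  sees only the increments of \<open>g\<close> between vertices.\<close>

lemma interpolate_H1: "interpolate a \<in> H1 G len"
  and energy_interpolate: "g \<in> H1 G len \<Longrightarrow> energy G len (interpolate a) g = dirichlet a (\<lambda>v. g (Vertex v))"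
proof -
  let ?p = "\<lambda>e (t::real). (a (head G e) - a (tail G e)) / len e"
  have h: "interpolate a \<in> H1 G len"
    "\<And>e. e \<in> arcs G \<Longrightarrow> is_weak_deriv (len e) (\<lambda>t. interpolate a (edge_point G len e t)) (?p e)"
    unfolding interpolate_def
    by (rule glue_H1[where p = ?p]; use len_pos in \<open>force intro!: continuous_intros is_weak_deriv_affine\<close>)+
  show "interpolate a \<in> H1 G len" by (rule h)
  assume g: "g \<in> H1 G len"
  have "energy G len (interpolate a) g = (\<Sum>e\<in>arcs G. integral {0..len e} (\<lambda>t. ?p e t * edge_deriv G len g e t))"
    by (rule energy_eq[OF h(1) g h(2) H1_weak_deriv[OF g]])
  also have "\<dots> = (\<Sum>e\<in>arcs G. ?p e 0 * (g (edge_point G len e (len e)) - g (edge_point G len e 0)))"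
    using len_pos by (intro sum.cong integral_unique has_integral_mult_right edge_deriv_has_integral[OF g]) (auto simp: less_imp_le)
  also have "\<dots> = dirichlet a (\<lambda>v. g (Vertex v))"
    unfolding dirichlet_def by (intro sum.cong) (auto simp: edge_point_simps)
  finally show "energy G len (interpolate a) g = dirichlet a (\<lambda>v. g (Vertex v))" .
qed

lemma dirichlet_commute: "dirichlet a b = dirichlet b a"
  by (simp add: dirichlet_def mult.commute)

lemma dirichlet_linear: "dirichlet (\<lambda>v. c * a v + d * b v) f = c * dirichlet a f + d * dirichlet b f"
proof -
  have "(c * p + d * q - (c * p' + d * q')) * z / l = c * ((p - p') * z / l) + d * ((q - q') * z / l)"
    for p q p' q' z l :: real
  proof -
    have "c * p + d * q - (c * p' + d * q') = c * (p - p') + d * (q - q')" by (simp add: algebra_simps)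
    then show ?thesis by (simp add: distrib_right add_divide_distrib mult.assoc)
  qed
  then show ?thesis by (simp add: dirichlet_def sum_distrib_left sum.distrib)
qed

lemma dirichlet_expand:
  assumes "finite T" "\<And>v. v \<in> verts G - T \<Longrightarrow> b v = 0"
  shows "dirichlet a b = (\<Sum>v\<in>T. b v * dirichlet a (indicator {v}))"
proof -
  have b: "b w = (\<Sum>v\<in>T. b v * indicator {v} w)" if "w \<in> verts G" for w
  proof -
    have "(\<Sum>v\<in>T. b v * indicator {v} w) = (\<Sum>v\<in>T. if w = v then b v else 0)"
      by (intro sum.cong) (auto simp: indicator_def)
    then show ?thesis using assms that by auto
  qed
  have "dirichlet a b = (\<Sum>e\<in>arcs G. \<Sum>v\<in>T. b v * ((a (head G e) - a (tail G e)) * (indicator {v} (head G e) - indicator {v} (tail G e)) / len e))"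
    unfolding dirichlet_def
  proof (rule sum.cong[OF refl])
    fix e assume e: "e \<in> arcs G"
    have "b (head G e) - b (tail G e) = (\<Sum>v\<in>T. b v * (indicator {v} (head G e) - indicator {v} (tail G e)))"
      using b[of "head G e"] b[of "tail G e"] e by (simp add: right_diff_distrib sum_subtractf)
    then show "(a (head G e) - a (tail G e)) * (b (head G e) - b (tail G e)) / len e =
       (\<Sum>v\<in>T. b v * ((a (head G e) - a (tail G e)) * (indicator {v} (head G e) - indicator {v} (tail G e)) / len e))"
      by (simp add: sum_distrib_left sum_divide_distrib mult.left_commute)
  qed
  also have "\<dots> = (\<Sum>v\<in>T. b v * dirichlet a (indicator {v}))"
    by (subst sum.swap) (simp add: dirichlet_def sum_distrib_left)
  finally show ?thesis .
qed

text \<open>A null vector of the form has equal values at the two ends of every edge. The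
  orthogonalisation below relies on this when the vector to be normalised is null.\<close>

lemma dirichlet_self_eq_0:
  assumes "dirichlet a a = 0" shows "dirichlet b a = 0"
proof -
  have "(\<Sum>e\<in>arcs G. (a (head G e) - a (tail G e))\<^sup>2 / len e) = 0"
    using assms by (simp add: dirichlet_def power2_eq_square)
  then have "\<forall>e\<in>arcs G. (a (head G e) - a (tail G e))\<^sup>2 / len e = 0"
    by (subst (asm) sum_nonneg_eq_0_iff) (use len_pos in \<open>auto intro!: divide_nonneg_pos\<close>)
  then have "\<forall>e\<in>arcs G. a (head G e) - a (tail G e) = 0" using len_pos by fastforce
  then show ?thesis by (simp add: dirichlet_def)
qed

text \<open>Gram--Schmidt orthogonalisation for the semidefinite Dirichlet form.\<close>

lemma dirichlet_projection:
  assumes "finite T"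
  shows "\<exists>p. (\<forall>v. v \<notin> T \<longrightarrow> p v = 0) \<and> (\<forall>v\<in>T. dirichlet (\<lambda>z. f z - p z) (indicator {v}) = 0)"
  using assms
proof (induction T arbitrary: f rule: finite_induct)
  case empty
  show ?case by (rule exI[of _ "\<lambda>_. 0"]) simp
next
  case (insert s T)
  obtain p where p: "\<And>v. v \<notin> T \<Longrightarrow> p v = 0" "\<And>v. v \<in> T \<Longrightarrow> dirichlet (\<lambda>z. f z - p z) (indicator {v}) = 0"
    using insert.IH[of f] by blast
  obtain q where q: "\<And>v. v \<notin> T \<Longrightarrow> q v = 0" "\<And>v. v \<in> T \<Longrightarrow> dirichlet (\<lambda>z. indicator {s} z - q z) (indicator {v}) = 0"
    using insert.IH[of "indicator {s}"] by blast
  define s' where "s' z = indicator {s} z - q z" for z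
  \<comment> \<open>When the denominator is 0, division makes \<open>c\<close> equal to 0, and
    orthogonality to \<open>s'\<close> then holds because \<open>s'\<close> is a null
    vector.\<close>
  define c where "c = dirichlet (\<lambda>z. f z - p z) s' / dirichlet s' s'"
  define k where "k z = 1 * (f z - p z) + (- c) * s' z" for z
  have kT: "dirichlet k (indicator {v}) = 0" if "v \<in> T" for v
    unfolding k_def dirichlet_linear using p(2)[OF that] q(2)[OF that] by (simp add: s'_def[abs_def])
  have "dirichlet k s' = 0"
  proof (cases "dirichlet s' s' = 0")
    case True then show ?thesis by (rule dirichlet_self_eq_0)
  next
    case False then show ?thesis unfolding k_def dirichlet_linear by (simp add: c_def)
  qed
  \<comment> \<open>\<open>q\<close> is supported in \<open>T\<close>, to which \<open>k\<close> is
    already orthogonal; with \<open>indicator {s} = s' + q\<close> this yields orthogonality at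
    \<open>s\<close>.\<close>
  moreover have "dirichlet k q = 0"
    using dirichlet_expand[OF insert(1), of q k] q(1) kT by simp
  moreover have "dirichlet k (indicator {s}) = dirichlet k s' + dirichlet k q"
    using dirichlet_linear[of 1 s' 1 q k] by (simp add: dirichlet_commute[of k] s'_def)
  ultimately have ks: "dirichlet k (indicator {s}) = 0" by simp
  have keq: "k = (\<lambda>z. f z - (p z + c * s' z))" by (simp add: k_def fun_eq_iff)
  show ?case
  proof (intro exI[of _ "\<lambda>z. p z + c * s' z"] conjI allI impI ballI)
    show "p v + c * s' v = 0" if "v \<notin> insert s T" for v
      using that p(1) q(1) by (simp add: s'_def)
    show "dirichlet (\<lambda>z. f z - (p z + c * s' z)) (indicator {v}) = 0" if "v \<in> insert s T" for v
      using that ks kT by (auto simp: keq)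
  qed
qed

text \<open>A function that is 1 at \<open>u\<close>, 0 at \<open>w\<close> and discretely harmonic
  at all other vertices pairs with \<open>b\<close> through \<open>b u\<close> and
  \<open>b w\<close> only, and testing with constants forces opposite weights. A multiple of its
  interpolant is the representer.\<close>

lemma represented_vertex_diff:
  assumes u: "u \<in> verts G" and w: "w \<in> verts G"
  shows "represented (\<lambda>g. g (Vertex u) - g (Vertex w))"
proof (cases "u = w")
  case True then show ?thesis using represented_0 by simp
next
  case False
  have fin: "finite (verts G - {u, w})" by simp
  obtain p where p: "\<And>v. v \<notin> verts G - {u, w} \<Longrightarrow> p v = 0"
    "\<And>v. v \<in> verts G - {u, w} \<Longrightarrow> dirichlet (\<lambda>z. indicator {u} z - p z) (indicator {v}) = 0"
    using dirichlet_projection[OF fin, of "indicator {u}"] by blast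
  define h where "h z = indicator {u} z - p z" for z
  define \<alpha> \<beta> where "\<alpha> = dirichlet h (indicator {u})" and "\<beta> = dirichlet h (indicator {w})"
  have e: "dirichlet h b = b u * \<alpha> + b w * \<beta>" for b
  proof -
    have "dirichlet h b = (\<Sum>v\<in>verts G. b v * dirichlet h (indicator {v}))"
      by (rule dirichlet_expand) auto
    also have "\<dots> = (\<Sum>v\<in>{u, w}. b v * dirichlet h (indicator {v}))"
      by (rule sum.mono_neutral_right) (use u w p(2) in \<open>auto simp: h_def[abs_def]\<close>)
    finally show ?thesis using False by (simp add: \<alpha>_def \<beta>_def)
  qed
  have "dirichlet h (\<lambda>_. 1) = 0" by (simp add: dirichlet_def)
  then have \<beta>: "\<beta> = - \<alpha>" using e[of "\<lambda>_. 1"] by simp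
  have e': "dirichlet h b = \<alpha> * (b u - b w)" for b
    using e[of b] unfolding \<beta> by (simp add: algebra_simps)
  have hv: "interpolate h (Vertex v) = h v" if "v \<in> verts G" for v
    using that by (simp add: interpolate_def glue_def gpoints_def)
  \<comment> \<open>Otherwise the interpolant would have zero energy and so be constant, against its
    values 1 at \<open>u\<close> and 0 at \<open>w\<close>. Connectedness enters through the paths
    behind \<open>energy_zero_imp_const\<close>.\<close>
  have "\<alpha> \<noteq> 0"
  proof
    assume "\<alpha> = 0"
    then have "energy G len (interpolate h) (interpolate h) = 0"
      by (simp add: energy_interpolate interpolate_H1 e')
    then have "interpolate h (Vertex u) = interpolate h (Vertex w)"
      using u w by (intro energy_zero_imp_const interpolate_H1) (auto simp: gpoints_def)
    then show False using False p(1)[of u] p(1)[of w] by (simp add: hv u w h_def)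
  qed
  have "represented (\<lambda>g. \<alpha> * (g (Vertex u) - g (Vertex w)))"
    unfolding represented_def using interpolate_H1 energy_interpolate e' by (intro bexI[of _ "interpolate h"]) auto
  from represented_linear[OF this represented_0, of "1 / \<alpha>" 0] \<open>\<alpha> \<noteq> 0\<close> show ?thesis by simp
qed

text \<open>At an interior point the tent functional differs from the desired one by vertex
  differences, because its end weights \<open>1 / 2 - c\<close> and \<open>1 / 2 + c\<close> sum to
  1.\<close>

lemma represented_diff_vertex:
  assumes x: "x \<in> gpoints G len" and w: "w \<in> verts G"
  shows "represented (\<lambda>g. g x - g (Vertex w))"
  using x
proof (cases rule: gpoint_cases)
  case (vertex v)
  then show ?thesis using represented_vertex_diff w by simp
next
  case (inner e b)
  obtain c where c: "represented (\<lambda>g. g (Inner e b) - (1 / 2 - c) * g (Vertex (head G e)) - (1 / 2 + c) * g (Vertex (tail G e)))"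
    using represented_inner inner by blast
  have "represented (\<lambda>g. 1 * (g (Inner e b) - (1 / 2 - c) * g (Vertex (head G e)) - (1 / 2 + c) * g (Vertex (tail G e)))
     + 1 * ((1 / 2 - c) * (g (Vertex (head G e)) - g (Vertex w)) + (1 / 2 + c) * (g (Vertex (tail G e)) - g (Vertex w))))"
    using inner(1) w by (intro represented_linear c represented_vertex_diff) auto
  then show ?thesis unfolding inner by (simp add: algebra_simps)
qed

lemma represented_diff:
  assumes x: "x \<in> gpoints G len" and y: "y \<in> gpoints G len"
  shows "represented (\<lambda>g. g x - g y)"
proof -
  obtain e where "e \<in> arcs G" using arcs_nonempty by blast
  then have w: "tail G e \<in> verts G" by auto
  show ?thesis
    using represented_linear[OF represented_diff_vertex[OF x w] represented_diff_vertex[OF y w], of 1 "- 1"] by simp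
qed

section \<open>The Cauchy-Schwarz inequality and the comparison of distance with resistance\<close>

lemma energy_cauchy_schwarz:
  assumes f: "f \<in> H1 G len" and g: "g \<in> H1 G len"
  shows "(energy G len f g)\<^sup>2 \<le> energy G len f f * energy G len g g"
proof -
  let ?a = "energy G len f f" and ?b = "energy G len f g" and ?c = "energy G len g g"
  have q: "0 \<le> s\<^sup>2 * ?a + 2 * s * t * ?b + t\<^sup>2 * ?c" for s t
  proof -
    have k: "(\<lambda>x. s * f x + t * g x) \<in> H1 G len" by (rule H1_linear[OF f g])
    have "energy G len (\<lambda>x. s * f x + t * g x) (\<lambda>x. s * f x + t * g x) = s * (s * ?a + t * ?b) + t * (s * ?b + t * ?c)"
      by (simp add: energy_linear_left[OF f g k] energy_linear_right[OF f g f] energy_linear_right[OF f g g] energy_commute[of g f])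
    also have "\<dots> = s\<^sup>2 * ?a + 2 * s * t * ?b + t\<^sup>2 * ?c" by (simp add: power2_eq_square algebra_simps)
    finally show ?thesis using energy_nonneg[OF k] by simp
  qed
  show ?thesis
  proof (cases "?c = 0")
    case True
    show ?thesis
    proof (rule ccontr)
      assume "\<not> ?thesis"
      then have b: "?b \<noteq> 0" using True by auto
      \<comment> \<open>The second coefficient is chosen to make the quadratic expression equal to
        -1.\<close>
      show False using q[of 1 "- (?a + 1) / (2 * ?b)"] b True energy_nonneg[OF f] by (simp add: field_simps)
    qed
  next
    case False
    then have c: "?c > 0" using energy_nonneg[OF g] by simp
    have "0 \<le> ?c * (?a * ?c - ?b\<^sup>2)" using q[of ?c "- ?b"] by (simp add: power2_eq_square algebra_simps)
    then show ?thesis using c by (simp add: zero_le_mult_iff)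
  qed
qed

text \<open>Away from the edge containing \<open>x\<close> the function below is, on each edge, the minimum of the
  distances to \<open>x\<close> through the two end points; both cases are written as combinations
  of functions \<open>\<bar>t - b\<bar>\<close>.\<close>

lemma distance_function:
  assumes x: "x \<in> gpoints G len"
  obtains k where "k \<in> H1 G len" "k x = 0" "\<And>y. y \<in> gpoints G len \<Longrightarrow> gdist G len x y \<le> k y"
    "energy G len k k \<le> total_length G len"
proof -
  define a where "a v = gdist G len x (Vertex v)" for v
  \<comment> \<open>\<open>P e + t\<close> and \<open>Q e - t\<close> are the distances from
    \<open>x\<close> to the point with parameter \<open>t\<close> by way of the tail and of the
    head; \<open>U\<close> is their minimum.\<close>
  define P where "P e = a (tail G e)" for e
  define Q where "Q e = a (head G e) + len e" for e
  define U where "U e t = (P e + Q e) / 2 - \<bar>t - (Q e - P e) / 2\<bar>" for e t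
  \<comment> \<open>For \<open>x\<close> at parameter \<open>s\<close> of \<open>e\<close> this is
    the minimum of \<open>P e + t\<close>, \<open>\<bar>t - s\<bar>\<close> and
    \<open>Q e - t\<close>: slopes 1, -1, 1, -1 with breaks at \<open>(s - P e) / 2\<close>,
    \<open>s\<close> and \<open>(s + Q e) / 2\<close>.\<close>
  define W where "W e s t = (P e + Q e) / 2 - \<bar>t - (s - P e) / 2\<bar> + \<bar>t - s\<bar> - \<bar>t - (s + Q e) / 2\<bar>" for e s t
  define u where "u e t = (case x of Vertex v \<Rightarrow> U e t | Inner e' s \<Rightarrow> if e = e' then W e s t else U e t)" for e t
  define p where "p e t = (case x of Vertex v \<Rightarrow> - sgn (t - (Q e - P e) / 2) |
     Inner e' s \<Rightarrow> if e = e' then - sgn (t - (s - P e) / 2) + sgn (t - s) - sgn (t - (s + Q e) / 2)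
        else - sgn (t - (Q e - P e) / 2))" for e t
  have U_w: "is_weak_deriv (len e) (U e) (\<lambda>t. - sgn (t - (Q e - P e) / 2))"
    and W_w: "is_weak_deriv (len e) (W e s) (\<lambda>t. - sgn (t - (s - P e) / 2) + sgn (t - s) - sgn (t - (s + Q e) / 2))"
    if "e \<in> arcs G" for e s
  proof -
    let ?w = "is_weak_deriv (len e)"
    note l = len_pos[OF that]
    have aff: "?w (\<lambda>t. (P e + Q e) / 2) (\<lambda>t. 0)" using is_weak_deriv_affine[OF l, of "(P e + Q e) / 2" 0] by simp
    have "?w (\<lambda>t. 1 * ((P e + Q e) / 2) + (- 1) * \<bar>t - (Q e - P e) / 2\<bar>) (\<lambda>t. 1 * 0 + (- 1) * sgn (t - (Q e - P e) / 2))"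
      by (intro is_weak_deriv_linear is_weak_deriv_abs aff l continuous_intros)
    then show "?w (U e) (\<lambda>t. - sgn (t - (Q e - P e) / 2))" by (simp add: U_def[abs_def])
    have "?w (\<lambda>t. 1 * (1 * (1 * ((P e + Q e) / 2) + (- 1) * \<bar>t - (s - P e) / 2\<bar>) + 1 * \<bar>t - s\<bar>) + (- 1) * \<bar>t - (s + Q e) / 2\<bar>)
       (\<lambda>t. 1 * (1 * (1 * 0 + (- 1) * sgn (t - (s - P e) / 2)) + 1 * sgn (t - s)) + (- 1) * sgn (t - (s + Q e) / 2))"
      by (intro is_weak_deriv_linear is_weak_deriv_abs aff l continuous_intros)
    then show "?w (W e s) (\<lambda>t. - sgn (t - (s - P e) / 2) + sgn (t - s) - sgn (t - (s + Q e) / 2))"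
      by (simp add: W_def[abs_def])
  qed
  have w: "is_weak_deriv (len e) (u e) (p e)" if "e \<in> arcs G" for e
  proof (cases x)
    case (Vertex v)
    then show ?thesis using U_w[OF that] by (simp add: u_def[abs_def] p_def[abs_def])
  next
    case (Inner e' s)
    then show ?thesis using U_w[OF that] W_w[OF that]
      by (cases "e = e'") (simp_all add: u_def[abs_def] p_def[abs_def])
  qed
  have uc: "continuous_on {0..len e} (u e)" for e
  proof (cases x)
    case (Vertex v)
    then show ?thesis by (auto simp: u_def[abs_def] U_def[abs_def] intro!: continuous_intros)
  next
    case (Inner e' s)
    then show ?thesis
      by (cases "e = e'") (auto simp: u_def[abs_def] U_def[abs_def] W_def[abs_def] intro!: continuous_intros)
  qed
  have PQ: "\<bar>P e - (Q e - len e)\<bar> \<le> len e" "0 \<le> P e" "len e \<le> Q e" if e: "e \<in> arcs G" for e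
  proof -
    show "\<bar>P e - (Q e - len e)\<bar> \<le> len e"
      using gdist_edge_le[OF x e, of 0 "len e"] gdist_edge_le[OF x e, of "len e" 0] len_pos[OF e]
      by (simp add: P_def Q_def a_def edge_point_simps[OF e])
    show "0 \<le> P e" "len e \<le> Q e" using e gdist_nonneg[OF x] by (auto simp: P_def Q_def a_def gpoints_def)
  qed
  \<comment> \<open>Together with \<open>PQ\<close> these bounds put the three breaks of
    \<open>W\<close> in order within the closed edge, so the alternating signs in its derivative
    cancel to absolute value at most 1.\<close>
  have PQ': "P e \<le> s" "Q e \<le> 2 * len e - s" "0 < s" "s < len e" "e \<in> arcs G" if xs: "x = Inner e s" for e s
  proof -
    show e: "e \<in> arcs G" and s: "0 < s" "s < len e" using x xs by (auto simp: gpoints_def)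
    have "edge_point G len e s = x" using xs e s by (simp add: edge_point_simps)
    then show "P e \<le> s" "Q e \<le> 2 * len e - s"
      using gdist_edge_le[OF x e, of s 0] gdist_edge_le[OF x e, of s "len e"] s gdist_self[OF x]
      by (auto simp: P_def Q_def a_def edge_point_simps[OF e])
  qed
  have ends: "u e 0 = a (tail G e)" "u e (len e) = a (head G e)" if e: "e \<in> arcs G" for e
  proof -
    have "P e \<le> Q e" "Q e - P e \<le> 2 * len e" using PQ(1)[OF e] by linarith+
    then have "U e 0 = P e" "U e (len e) = Q e - len e" by (simp_all add: U_def abs_if field_simps)
    moreover have "W e s 0 = P e" "W e s (len e) = Q e - len e" if "x = Inner e s" for s
      using PQ'[OF that] PQ(2,3)[OF e] by (simp_all add: W_def abs_if field_simps)
    moreover have "P e = a (tail G e)" "Q e - len e = a (head G e)" by (auto simp: P_def Q_def)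
    ultimately show "u e 0 = a (tail G e)" "u e (len e) = a (head G e)"
      by (auto simp: u_def split: gpoint.split)
  qed
  have k: "glue a u \<in> H1 G len"
    "\<And>e. e \<in> arcs G \<Longrightarrow> is_weak_deriv (len e) (\<lambda>t. glue a u (edge_point G len e t)) (p e)"
    by (rule glue_H1[OF ends uc w]; assumption)+
  have "glue a u x = 0"
    using x
  proof (cases rule: gpoint_cases)
    case (vertex v) then show ?thesis using x gdist_self[OF x] by (simp add: glue_def a_def)
  next
    case (inner e s)
    have "W e s s = 0" using PQ'[OF inner(4)] PQ(2,3)[OF inner(1)] by (simp add: W_def abs_if field_simps)
    then show ?thesis using x inner by (simp add: glue_def u_def)
  qed
  moreover have "gdist G len x y \<le> glue a u y" if y: "y \<in> gpoints G len" for y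
    using y
  proof (cases rule: gpoint_cases)
    case (vertex v) then show ?thesis using y by (simp add: glue_def a_def)
  next
    case (inner e t)
    then have t: "t \<in> {0..len e}" and yt: "y = edge_point G len e t" by (auto simp: edge_point_simps)
    have "gdist G len x y \<le> P e + t" "gdist G len x y \<le> Q e - t"
      using gdist_edge_le[OF x inner(1) _ t, of 0] gdist_edge_le[OF x inner(1) _ t, of "len e"] t
      by (auto simp: P_def Q_def a_def edge_point_simps[OF inner(1)] yt)
    moreover have "gdist G len x y \<le> \<bar>t - s\<bar>" if "x = Inner e s" for s
    proof -
      note s = PQ'[OF that]
      then have "edge_point G len e s = x" using that by (simp add: edge_point_simps)
      then show ?thesis using gdist_edge_le[OF x inner(1) _ t, of s] s gdist_self[OF x] by (simp add: yt)
    qed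
    moreover have "U e t = P e + t \<or> U e t = Q e - t" by (simp add: U_def abs_if field_simps)
    moreover have "W e s t = P e + t \<or> W e s t = Q e - t \<or> W e s t = \<bar>t - s\<bar>" if "x = Inner e s" for s
      using PQ'[OF that] PQ(2,3)[OF inner(1)] by (simp add: W_def abs_if field_simps)
    moreover have "glue a u y = u e t" using y inner by (simp add: glue_def)
    ultimately show ?thesis by (auto simp: u_def split: gpoint.split)
  qed
  moreover have "energy G len (glue a u) (glue a u) \<le> total_length G len"
  proof -
    have "energy G len (glue a u) (glue a u) = (\<Sum>e\<in>arcs G. integral {0..len e} (\<lambda>t. p e t * p e t))"
      by (rule energy_eq[OF k(1) k(1) k(2) k(2)])
    also have "\<dots> \<le> (\<Sum>e\<in>arcs G. integral {0..len e} (\<lambda>t. 1))"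
    proof (intro sum_mono integral_le)
      fix e t assume e: "e \<in> arcs G"
      have "\<bar>p e t\<bar> \<le> 1"
      proof (cases x)
        case s: (Inner e' s)
        show ?thesis
        proof (cases "e = e'")
          case True
          then show ?thesis using PQ'[OF s] PQ(2,3)[OF e] by (simp add: p_def s sgn_if)
        qed (simp add: p_def s sgn_if)
      qed (simp add: p_def sgn_if)
      then show "p e t * p e t \<le> 1" using mult_le_one[of "\<bar>p e t\<bar>" "\<bar>p e t\<bar>"] by simp
      show "(\<lambda>t. p e t * p e t) integrable_on {0..len e}"
        using w[OF e] by (intro square_integrable_mult_integrable_on) (auto simp: is_weak_deriv_def)
    qed (auto intro: integrable_continuous_interval)
    also have "\<dots> = total_length G len"
      unfolding total_length_def using len_pos by (intro sum.cong) (auto simp: less_imp_le)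
    finally show ?thesis .
  qed
  ultimately show ?thesis using k(1) that by blast
qed

text \<open>The increment \<open>h x - h y\<close> is the effective resistance between \<open>x\<close> and \<open>y\<close>.\<close>

lemma gdist_square_le_resistance:
  assumes x: "x \<in> gpoints G len" and y: "y \<in> gpoints G len" and h: "h \<in> H1 G len"
    and rep: "\<And>g. g \<in> H1 G len \<Longrightarrow> energy G len h g = g x - g y"
  shows "(gdist G len x y)\<^sup>2 \<le> (h x - h y) * total_length G len"
proof -
  obtain k where k: "k \<in> H1 G len" "k x = 0" "gdist G len x y \<le> k y" "energy G len k k \<le> total_length G len"
    using distance_function[OF x] y by metis
  have "(gdist G len x y)\<^sup>2 \<le> (k y)\<^sup>2" using k(3) gdist_nonneg[OF x y] by (intro power_mono)
  also have "\<dots> = (energy G len h k)\<^sup>2" by (simp add: rep k)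
  also have "\<dots> \<le> energy G len h h * energy G len k k" by (rule energy_cauchy_schwarz[OF h k(1)])
  also have "\<dots> \<le> energy G len h h * total_length G len" using energy_nonneg[OF h] k(4) by (rule mult_left_mono[rotated])
  finally show ?thesis by (simp add: rep h)
qed

section \<open>Eigenvalues\<close>

lemma H1_bounded:
  assumes f: "f \<in> H1 G len" obtains B where "\<And>x. \<bar>f x\<bar> \<le> B"
proof -
  obtain e where "e \<in> arcs G" using arcs_nonempty by blast
  then have x0: "Vertex (tail G e) \<in> gpoints G len" by (auto simp: gpoints_def)
  define c where "c = sqrt (gdiam G len * energy G len f f)"
  have "\<bar>f x\<bar> \<le> \<bar>f (Vertex (tail G e))\<bar> + c" for x
  proof (cases "x \<in> gpoints G len")
    case True
    have "\<bar>f x - f (Vertex (tail G e))\<bar> \<le> c"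
      unfolding c_def by (rule real_le_rsqrt) (use increment_square_le_gdiam[OF f True x0] in simp)
    then show ?thesis by linarith
  next
    case False
    then have "f x = 0" using f by (auto simp: H1_def)
    moreover have "c \<ge> 0" using gdiam_pos energy_nonneg[OF f] by (simp add: c_def)
    ultimately show ?thesis by simp
  qed
  then show ?thesis using that by blast
qed

lemma const_eq_scale_one:
  assumes "f \<in> H1 G len" "\<And>x. x \<in> gpoints G len \<Longrightarrow> f x = c" shows "f = fun_scale c one"
  using assms by (auto simp: fun_scale_def one_def fun_eq_iff H1_def)

lemma one_H1_mu: "one \<in> H1_mu G len \<mu>"
  by (simp add: H1_mu_def one_H1 harmonic_on_def energy_one)

section \<open>Integrability with respect to a Borel probability measure, and the variance
  estimate\<close>

lemma H1_borel_measurable: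
  assumes \<mu>: "borel_prob G len \<mu>" and f: "f \<in> H1 G len" shows "f \<in> borel_measurable \<mu>"
proof (rule borel_measurableI)
  fix S :: "real set" assume "open S"
  then have "openin (gtop G len) {x \<in> topspace (gtop G len). f x \<in> S}"
    using f by (auto simp: H1_def continuous_map_def)
  moreover have "f -` S \<inter> space \<mu> = {x \<in> topspace (gtop G len). f x \<in> S}"
    using \<mu> by (auto simp: borel_prob_def topspace_gtop)
  ultimately show "f -` S \<inter> space \<mu> \<in> sets \<mu>"
    using \<mu> by (auto simp: borel_prob_def intro: sigma_sets.Basic)
qed

lemma H1_integrable:
  assumes \<mu>: "borel_prob G len \<mu>" and f: "f \<in> H1 G len" shows "integrable \<mu> f"
proof -
  interpret prob_space \<mu> using \<mu> by (simp add: borel_prob_def)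
  obtain B where "\<And>x. \<bar>f x\<bar> \<le> B" using H1_bounded[OF f] by blast
  then show ?thesis by (intro integrable_const_bound[of _ B] H1_borel_measurable[OF \<mu> f]) auto
qed

lemma H1_square_integrable_mu:
  assumes \<mu>: "borel_prob G len \<mu>" and f: "f \<in> H1 G len" shows "integrable \<mu> (\<lambda>x. (f x)\<^sup>2)"
proof -
  interpret prob_space \<mu> using \<mu> by (simp add: borel_prob_def)
  obtain B where "\<And>x. \<bar>f x\<bar> \<le> B" using H1_bounded[OF f] by blast
  then have "\<And>x. \<bar>f x\<bar>\<^sup>2 \<le> B\<^sup>2" by (intro power_mono) auto
  then show ?thesis
    using H1_borel_measurable[OF \<mu> f] by (intro integrable_const_bound[of _ "B\<^sup>2"]) auto
qed

text \<open>The product \<open>(M - f x) * (f x - m)\<close> is nonnegative; integrating it with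
  mean zero bounds the second moment by \<open>- (M * m)\<close>.\<close>

lemma variance_bound:
  assumes \<mu>: "borel_prob G len \<mu>" and f: "f \<in> H1 G len" and 0: "(LINT x|\<mu>. f x) = 0"
  shows "4 * (LINT x|\<mu>. (f x)\<^sup>2) \<le> gdiam G len * energy G len f f"
proof -
  interpret prob_space \<mu> using \<mu> by (simp add: borel_prob_def)
  have sp: "space \<mu> = gpoints G len" using \<mu> by (simp add: borel_prob_def)
  have ne: "gpoints G len \<noteq> {}" using not_empty sp by simp
  obtain B where B: "\<And>x. \<bar>f x\<bar> \<le> B" using H1_bounded[OF f] by blast
  have bdd: "bdd_above (f ` gpoints G len)" "bdd_below (f ` gpoints G len)"
    using B by (auto intro!: bdd_aboveI[of _ B] bdd_belowI[of _ "- B"] simp: abs_le_iff) (metis minus_le_iff)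
  define c where "c = gdiam G len * energy G len f f"
  have c: "c \<ge> 0" using gdiam_pos energy_nonneg[OF f] by (simp add: c_def)
  define M m where "M = Sup (f ` gpoints G len)" and "m = Inf (f ` gpoints G len)"
  have fM: "m \<le> f x" "f x \<le> M" if "x \<in> gpoints G len" for x
    using bdd that by (auto simp: M_def m_def intro: cInf_lower cSup_upper)
  have "f x \<le> f y + sqrt c" if "x \<in> gpoints G len" "y \<in> gpoints G len" for x y
  proof -
    have "\<bar>f x - f y\<bar> \<le> sqrt c" by (rule real_le_rsqrt) (use increment_square_le_gdiam[OF f that] in \<open>simp add: c_def\<close>)
    then show ?thesis by linarith
  qed
  then have "M \<le> f y + sqrt c" if "y \<in> gpoints G len" for y
    unfolding M_def using ne that by (intro cSup_least) auto
  then have "M - sqrt c \<le> f y" if "y \<in> gpoints G len" for y using that by (simp add: diff_le_eq)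
  then have "M - sqrt c \<le> m" unfolding m_def using ne by (intro cInf_greatest) auto
  moreover have "m \<le> M" using ne fM order_trans by blast
  ultimately have "(M - m)\<^sup>2 \<le> (sqrt c)\<^sup>2" by (intro power_mono) auto
  then have Mm: "(M - m)\<^sup>2 \<le> c" using c by simp
  note i = H1_integrable[OF \<mu> f] H1_square_integrable_mu[OF \<mu> f]
  have "(LINT x|\<mu>. (f x)\<^sup>2) \<le> (LINT x|\<mu>. (M + m) * f x - M * m)"
  proof (rule integral_mono)
    fix x assume "x \<in> space \<mu>"
    then have "0 \<le> (M - f x) * (f x - m)" using fM sp by simp
    then show "(f x)\<^sup>2 \<le> (M + m) * f x - M * m" by (simp add: algebra_simps power2_eq_square)
  qed (use i in auto)
  also have "\<dots> = - (M * m)" using i 0 by (simp add: prob_space)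
  \<comment> \<open>The two sides differ by \<open>(M + m)^2\<close>.\<close>
  also have "4 * - (M * m) \<le> (M - m)\<^sup>2"
    using zero_le_power2[of "M + m"] by (simp add: power2_eq_square algebra_simps)
  finally show ?thesis using Mm by (simp add: c_def)
qed

text \<open>Testing the eigenvalue equation with \<open>f\<close> makes the energy equal to \<nu>
  times the second moment; testing with \<open>one\<close> gives mean zero when \<nu> is not 0. Zero
  energy leaves only constants, and a nonzero constant forces \<nu> to be 0, which also disposes of
  negative \<nu>.\<close>

lemma eigenfunction_cases:
  assumes \<mu>: "borel_prob G len \<mu>" and f: "f \<in> eigenspace G len \<mu> \<nu>"
  obtains "f = (\<lambda>_. 0)" | c where "\<nu> = 0" "f = fun_scale c one" | "4 / gdiam G len \<le> \<nu>"
proof -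
  interpret prob_space \<mu> using \<mu> by (simp add: borel_prob_def)
  have sp: "space \<mu> = gpoints G len" using \<mu> by (simp add: borel_prob_def)
  have fm: "f \<in> H1_mu G len \<mu>" and eq: "\<And>\<phi>. \<phi> \<in> H1_mu G len \<mu> \<Longrightarrow> energy G len f \<phi> = (LINT x|\<mu>. \<nu> * f x * \<phi> x)"
    using f by (auto simp: eigenspace_def op_graph_def)
  have fH: "f \<in> H1 G len" using fm by (simp add: H1_mu_def)
  have E: "energy G len f f = \<nu> * (LINT x|\<mu>. (f x)\<^sup>2)"
    using eq[OF fm] by (simp add: power2_eq_square mult.assoc)
  have I: "0 \<le> (LINT x|\<mu>. (f x)\<^sup>2)" by simp
  show ?thesis
  proof (cases "energy G len f f = 0")
    case True
    obtain x0 where x0: "x0 \<in> gpoints G len" using not_empty sp by blast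
    define c where "c = f x0"
    have fc: "f x = c" if "x \<in> gpoints G len" for x
      using energy_zero_imp_const[OF fH True that x0] by (simp add: c_def)
    then have fone: "f = fun_scale c one" by (rule const_eq_scale_one[OF fH])
    have "(LINT x|\<mu>. (f x)\<^sup>2) = (LINT x|\<mu>. c\<^sup>2)"
      by (rule Bochner_Integration.integral_cong) (auto simp: sp fc)
    then have "(LINT x|\<mu>. (f x)\<^sup>2) = c\<^sup>2" by (simp add: prob_space)
    then have "\<nu> = 0 \<or> c = 0" using E True by simp
    then show ?thesis using that(1,2) fone by (auto simp: fun_scale_def)
  next
    case False
    then have "0 < energy G len f f" using energy_nonneg[OF fH] by simp
    then have \<nu>: "\<nu> > 0" and I0: "(LINT x|\<mu>. (f x)\<^sup>2) > 0" using E I by (auto simp: zero_less_mult_iff)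
    have "energy G len f one = 0" using energy_one[OF fH] by (simp add: energy_commute)
    also have "energy G len f one = (LINT x|\<mu>. \<nu> * f x)"
      unfolding eq[OF one_H1_mu] by (rule Bochner_Integration.integral_cong) (auto simp: sp one_def)
    finally have "(LINT x|\<mu>. f x) = 0" using \<nu> by simp
    from variance_bound[OF \<mu> fH this] have "4 * (LINT x|\<mu>. (f x)\<^sup>2) \<le> gdiam G len * \<nu> * (LINT x|\<mu>. (f x)\<^sup>2)"
      by (simp add: E mult.assoc)
    then have "4 \<le> gdiam G len * \<nu>" using I0 by (rule mult_right_le_imp_le)
    then show ?thesis using that(3) gdiam_pos by (simp add: divide_le_eq mult.commute)
  qed
qed

text \<open>Below \<open>4 / gdiam G len\<close> only the eigenvalue 0 occurs, with constant
  eigenfunctions, so the total multiplicity there is at most 1, whereas index 1 demands more than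
  1.\<close>

lemma eigenvalue_1_ge:
  assumes \<mu>: "borel_prob G len \<mu>" shows "ereal (4 / gdiam G len) \<le> eigenvalue G len \<mu> 1"
  unfolding eigenvalue_def
proof (rule Inf_greatest)
  interpret V: vector_space fun_scale by (rule vector_space_fun_scale)
  fix z assume "z \<in> {ereal \<Lambda> |\<Lambda>. \<exists>F. finite F \<and> F \<subseteq> {..\<Lambda>} \<and> 1 < (\<Sum>\<nu>\<in>F. eigen_multiplicity G len \<mu> \<nu>)}"
  then obtain \<Lambda> F where z: "z = ereal \<Lambda>" and F: "finite F" "F \<subseteq> {..\<Lambda>}" "1 < (\<Sum>\<nu>\<in>F. eigen_multiplicity G len \<mu> \<nu>)"
    by blast
  have "4 / gdiam G len \<le> \<Lambda>"
  proof (rule ccontr)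
    assume n: "\<not> ?thesis"
    have m: "eigen_multiplicity G len \<mu> \<nu> \<le> (if \<nu> = 0 then 1 else 0)" if "\<nu> \<in> F" for \<nu>
    proof -
      have \<nu>: "\<not> 4 / gdiam G len \<le> \<nu>" using that F(2) n by auto
      have z: "(\<lambda>_. 0) \<in> V.span S" for S using V.span_zero by (simp add: zero_fun_def)
      show ?thesis
      proof (cases "\<nu> = 0")
        case True
        have "eigenspace G len \<mu> \<nu> \<subseteq> V.span {one}"
        proof
          fix f assume "f \<in> eigenspace G len \<mu> \<nu>"
          then show "f \<in> V.span {one}"
            using \<nu> z[of "{one}"] by (cases rule: eigenfunction_cases[OF \<mu>]) (auto simp: V.span_singleton)
        qed
        from V.dim_le_card[OF this] True show ?thesis by (simp add: eigen_multiplicity_def)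
      next
        case False
        have "eigenspace G len \<mu> \<nu> \<subseteq> V.span {}"
        proof
          fix f assume "f \<in> eigenspace G len \<mu> \<nu>"
          then show "f \<in> V.span {}"
            using \<nu> z False by (cases rule: eigenfunction_cases[OF \<mu>]) auto
        qed
        from V.dim_le_card[OF this] False show ?thesis by (simp add: eigen_multiplicity_def)
      qed
    qed
    have "(\<Sum>\<nu>\<in>F. eigen_multiplicity G len \<mu> \<nu>) \<le> (\<Sum>\<nu>\<in>F. if \<nu> = 0 then 1 else 0)"
      by (rule sum_mono) (rule m)
    also have "\<dots> \<le> 1" using F(1) by simp
    finally show False using F(3) by simp
  qed
  then show "ereal (4 / gdiam G len) \<le> z" by (simp add: z)
qed

section \<open>Measures with mass 1/2 at each of two points\<close>

definition two_point :: "('v, 'e) gpoint \<Rightarrow> ('v, 'e) gpoint \<Rightarrow> ('v, 'e) gpoint measure" where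
  "two_point x y = distr (measure_pmf (bernoulli_pmf (1 / 2)))
     (sigma (gpoints G len) {U. openin (gtop G len) U}) (\<lambda>b. if b then x else y)"

context
  fixes x y assumes x: "x \<in> gpoints G len" and y: "y \<in> gpoints G len"
begin

lemma two_point_measurable:
  "(\<lambda>b. if b then x else y) \<in> measurable (measure_pmf (bernoulli_pmf (1 / 2))) (sigma (gpoints G len) {U. openin (gtop G len) U})"
  using x y by (auto simp: space_measure_of_conv)

lemma borel_prob_two_point: "borel_prob G len (two_point x y)"
proof -
  have "{U. openin (gtop G len) U} \<subseteq> Pow (gpoints G len)" by (auto simp: openin_gtop)
  then show ?thesis
    unfolding borel_prob_def two_point_def
    using measure_pmf.prob_space_distr[OF two_point_measurable] by (simp add: space_measure_of_conv)
qed

lemma integral_two_point: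
  fixes f :: "('v, 'e) gpoint \<Rightarrow> real"
  assumes "f \<in> borel_measurable (two_point x y)"
  shows "(LINT z|two_point x y. f z) = (f x + f y) / 2"
proof -
  have "f \<in> borel_measurable (sigma (gpoints G len) {U. openin (gtop G len) U})"
    using assms by (simp add: two_point_def)
  then show ?thesis
    unfolding two_point_def by (subst integral_distr[OF two_point_measurable]) (auto simp: integral_bernoulli_pmf field_simps)
qed

lemma supp_two_point: "supp G len (two_point x y) = {x, y}"
proof -
  have em: "emeasure (two_point x y) U = emeasure (measure_pmf (bernoulli_pmf (1 / 2))) {b. (if b then x else y) \<in> U}"
    if "openin (gtop G len) U" for U
  proof -
    have "{U. openin (gtop G len) U} \<subseteq> Pow (gpoints G len)" by (auto simp: openin_gtop)
    then show ?thesis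
      unfolding two_point_def using that by (subst emeasure_distr[OF two_point_measurable]) (auto simp: vimage_def intro: sigma_sets.Basic)
  qed
  have pos: "0 < emeasure (measure_pmf (bernoulli_pmf (1 / 2))) S" if "b \<in> S" for b :: bool and S
  proof -
    have "0 < pmf (bernoulli_pmf (1 / 2)) b" by (cases b) simp_all
    then have "0 < emeasure (measure_pmf (bernoulli_pmf (1 / 2))) {b}"
      by (simp only: emeasure_pmf_single ennreal_less_zero_iff)
    also have "\<dots> \<le> emeasure (measure_pmf (bernoulli_pmf (1 / 2))) S" using that by (intro emeasure_mono) auto
    finally show ?thesis .
  qed
  have op: "openin (gtop G len) (gpoints G len - {x, y})"
    unfolding openin_gtop
  proof (intro conjI ballI)
    fix e assume e: "e \<in> arcs G"
    \<comment> \<open>A point has finitely many parameters on an edge; on a loop its vertex has both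
      0 and \<open>len e\<close>.\<close>
    have "finite {t. edge_point G len e t = z}" for z :: "('v, 'e) gpoint"
      by (rule finite_subset[of _ "{0, len e, case z of Inner e t \<Rightarrow> t | _ \<Rightarrow> 0}"]) (auto simp: edge_point_def split: if_splits)
    then have "closed ({t. edge_point G len e t = x} \<union> {t. edge_point G len e t = y})" by (intro finite_imp_closed) simp
    then have "openin (top_of_set {0..len e}) ({0..len e} \<inter> - ({t. edge_point G len e t = x} \<union> {t. edge_point G len e t = y}))"
      by (intro openin_open_Int open_Compl)
    moreover have "{t \<in> {0..len e}. edge_point G len e t \<in> gpoints G len - {x, y}} =
      {0..len e} \<inter> - ({t. edge_point G len e t = x} \<union> {t. edge_point G len e t = y})"
      using edge_point_in_gpoints[OF e] by auto
    ultimately show "openin (top_of_set {0..len e}) {t \<in> {0..len e}. edge_point G len e t \<in> gpoints G len - {x, y}}" by simp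
  qed auto
  have "z \<in> {x, y}" if "z \<in> supp G len (two_point x y)" for z
  proof (rule ccontr)
    assume "z \<notin> {x, y}"
    then have "0 < emeasure (two_point x y) (gpoints G len - {x, y})"
      using that op by (auto simp: supp_def)
    moreover have "{b. (if b then x else y) \<in> gpoints G len - {x, y}} = {}" by auto
    ultimately show False unfolding em[OF op] by (simp only:) simp
  qed
  moreover have "x \<in> supp G len (two_point x y)"
    unfolding supp_def using x by (auto simp: em intro!: pos[of True])
  moreover have "y \<in> supp G len (two_point x y)"
    unfolding supp_def using y by (auto simp: em intro!: pos[of False])
  ultimately show ?thesis by blast
qed

lemma H1_mu_two_point:
  "f \<in> H1_mu G len (two_point x y) \<longleftrightarrow>
     f \<in> H1 G len \<and> (\<forall>g\<in>H1 G len. g x = 0 \<and> g y = 0 \<longrightarrow> energy G len f g = 0)"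
proof -
  have "gpoints G len - (gpoints G len - {x, y}) = {x, y}" using x y by auto
  then show ?thesis by (simp add: H1_mu_def harmonic_on_def supp_two_point)
qed

lemma eigenspace_two_point:
  "f \<in> eigenspace G len (two_point x y) \<nu> \<longleftrightarrow> f \<in> H1_mu G len (two_point x y) \<and>
    (\<forall>\<phi>\<in>H1_mu G len (two_point x y). energy G len f \<phi> = \<nu> * (f x * \<phi> x + f y * \<phi> y) / 2)"
proof (cases "f \<in> H1_mu G len (two_point x y)")
  case True
  note b = borel_prob_two_point
  have f: "f \<in> H1 G len" using True by (simp add: H1_mu_def)
  note m = H1_borel_measurable[OF b]
  have I: "(LINT z|two_point x y. \<nu> * f z * \<phi> z) = \<nu> * (f x * \<phi> x + f y * \<phi> y) / 2" if "\<phi> \<in> H1_mu G len (two_point x y)" for \<phi>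
  proof -
    have "\<phi> \<in> H1 G len" using that by (simp add: H1_mu_def)
    then have "(\<lambda>z. \<nu> * f z * \<phi> z) \<in> borel_measurable (two_point x y)" using m f by (intro borel_measurable_times) auto
    from integral_two_point[OF this] show ?thesis by (simp only:) (simp add: algebra_simps)
  qed
  have "integrable (two_point x y) (\<lambda>z. (\<nu> * f z)\<^sup>2)"
    using H1_square_integrable_mu[OF b f] by (simp add: power_mult_distrib)
  moreover have "(\<lambda>z. \<nu> * f z) \<in> borel_measurable (two_point x y)" using m[OF f] by simp
  ultimately show ?thesis using True by (auto simp add: eigenspace_def op_graph_def I)
qed (simp add: eigenspace_def op_graph_def)

text \<open>The eigenvalues 0 and \<open>4 / R\<close> together have multiplicity 2, so the
  eigenvalue of index 1 is at most \<open>4 / R\<close>; the resistance bound then brings in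
  distance and length.\<close>

lemma eigenvalue_two_point_le:
  assumes d: "0 < gdist G len x y"
  shows "eigenvalue G len (two_point x y) 1 \<le> ereal (4 * total_length G len / (gdist G len x y)\<^sup>2)"
proof -
  interpret V: vector_space fun_scale by (rule vector_space_fun_scale)
  obtain h0 where h0: "h0 \<in> H1 G len" "\<And>g. g \<in> H1 G len \<Longrightarrow> energy G len h0 g = g x - g y"
    using represented_diff[OF x y] unfolding represented_def by blast
  define R where "R = h0 x - h0 y"
  have dR: "(gdist G len x y)\<^sup>2 \<le> R * total_length G len"
    unfolding R_def by (rule gdist_square_le_resistance[OF x y h0])
  have L: "0 \<le> total_length G len" unfolding total_length_def by (intro sum_nonneg) (auto simp: len_pos less_imp_le)
  have "0 < R * total_length G len" using dR d by (smt (verit) zero_less_power)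
  then have R: "R > 0" using L by (simp add: zero_less_mult_iff)
  have one_xy: "one x = 1" "one y = 1" using x y by (auto simp: one_def)
  \<comment> \<open>A constant shift leaves the energy pairing unchanged and makes the values at
    \<open>x\<close> and \<open>y\<close> equal to \<open>R / 2\<close> and \<open>- R / 2\<close>.
    Then \<open>\<nu> * (h x * g x + h y * g y) / 2\<close> is \<open>g x - g y\<close> exactly for
    \<open>\<nu> = 4 / R\<close>.\<close>
  define h where "h = (\<lambda>z. 1 * h0 z + (- (h0 x + h0 y) / 2) * one z)"
  have hH: "h \<in> H1 G len" unfolding h_def by (intro H1_linear h0 one_H1)
  have hE: "energy G len h g = g x - g y" if "g \<in> H1 G len" for g
    unfolding h_def energy_linear_left[OF h0(1) one_H1 that] by (simp add: h0(2) energy_one that)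
  have hxy: "h x = R / 2" "h y = - R / 2" by (simp_all add: h_def one_xy R_def field_simps)
  have hmu: "h \<in> H1_mu G len (two_point x y)" by (simp add: H1_mu_two_point hH hE)
  have "x \<noteq> y" using d gdist_self[OF x] by auto
  note b = borel_prob_two_point
  \<comment> \<open>The eigenspaces are identified exactly: an eigenfunction alone would not bound
    the multiplicity from below, because \<open>dim\<close> is 0 by convention on
    infinite-dimensional spaces.\<close>
  have 0: "eigenspace G len (two_point x y) 0 = V.span {one}"
  proof (intro subset_antisym subsetI)
    fix f assume f: "f \<in> eigenspace G len (two_point x y) 0"
    have z: "(\<lambda>_. 0) \<in> V.span {one}" using V.span_zero by (simp add: zero_fun_def)
    from f show "f \<in> V.span {one}"
      using z gdiam_pos by (cases rule: eigenfunction_cases[OF b]) (auto simp: V.span_singleton divide_le_0_iff)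
  next
    fix f assume "f \<in> V.span {one}"
    then obtain c where c: "f = fun_scale c one" by (auto simp: V.span_singleton)
    have "f = (\<lambda>z. c * one z + 0 * one z)" by (simp add: c fun_scale_def)
    then have "f \<in> H1 G len" "\<And>g. g \<in> H1 G len \<Longrightarrow> energy G len f g = 0"
      using H1_linear[OF one_H1 one_H1, of c 0] energy_linear_left[OF one_H1 one_H1, of _ c 0] energy_one by auto
    then show "f \<in> eigenspace G len (two_point x y) 0"
      by (auto simp: eigenspace_two_point H1_mu_two_point)
  qed
  have 1: "eigenspace G len (two_point x y) (4 / R) = V.span {h}"
  proof (intro subset_antisym subsetI)
    fix f assume f: "f \<in> eigenspace G len (two_point x y) (4 / R)"
    then have fH: "f \<in> H1 G len" and fm: "\<And>g. g \<in> H1 G len \<Longrightarrow> g x = 0 \<Longrightarrow> g y = 0 \<Longrightarrow> energy G len f g = 0"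
      and "energy G len f one = 4 / R * (f x * one x + f y * one y) / 2"
      using one_H1_mu by (auto simp: eigenspace_two_point H1_mu_two_point)
    moreover have "energy G len f one = 0" using energy_one[OF fH] by (simp add: energy_commute)
    ultimately have fxy: "f y = - f x" using R by (simp add: one_xy)
    define c where "c = f x / (R / 2)"
    \<comment> \<open>\<open>k\<close> vanishes at \<open>x\<close> and \<open>y\<close>, so
      \<open>f\<close> and \<open>h\<close> both have zero energy pairing with it. Hence its energy
      is 0, and it is constant with value 0.\<close>
    define k where "k = (\<lambda>z. 1 * f z + (- c) * h z)"
    have kH: "k \<in> H1 G len" unfolding k_def by (intro H1_linear fH hH)
    have kxy: "k x = 0" "k y = 0" using R by (simp_all add: k_def hxy c_def fxy)
    have "energy G len k k = 1 * energy G len f k + (- c) * energy G len h k"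
      using energy_linear_left[OF fH hH kH, of 1 "- c"] by (simp add: k_def)
    then have "energy G len k k = 0" by (simp add: fm kH kxy hE)
    then have "k z = k x" if "z \<in> gpoints G len" for z using energy_zero_imp_const[OF kH _ that x] by simp
    then have "k z = 0" for z using kxy kH by (cases "z \<in> gpoints G len") (auto simp: H1_def)
    then have "f = fun_scale c h" by (auto simp: fun_eq_iff fun_scale_def k_def)
    then show "f \<in> V.span {h}" by (auto simp: V.span_singleton)
  next
    fix f assume "f \<in> V.span {h}"
    then obtain c where c: "f = fun_scale c h" by (auto simp: V.span_singleton)
    have "f = (\<lambda>z. c * h z + 0 * h z)" by (simp add: c fun_scale_def)
    then have fE: "f \<in> H1 G len" "\<And>g. g \<in> H1 G len \<Longrightarrow> energy G len f g = c * (g x - g y)"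
      using H1_linear[OF hH hH, of c 0] energy_linear_left[OF hH hH, of _ c 0] hE by auto
    have fxy: "f x = c * R / 2" "f y = - (c * R / 2)" by (simp_all add: c fun_scale_def hxy)
    have "energy G len f \<phi> = 4 / R * (f x * \<phi> x + f y * \<phi> y) / 2" if "\<phi> \<in> H1 G len" for \<phi>
      unfolding fE(2)[OF that] fxy using R by (simp add: field_simps)
    then show "f \<in> eigenspace G len (two_point x y) (4 / R)"
      by (simp add: eigenspace_two_point H1_mu_two_point fE)
  qed
  have "one \<noteq> 0" using one_xy(1) by (auto simp: fun_eq_iff intro!: exI[of _ x])
  moreover have "h \<noteq> 0" using hxy(1) R by (auto simp: fun_eq_iff intro!: exI[of _ x])
  ultimately have dims: "eigen_multiplicity G len (two_point x y) 0 = 1" "eigen_multiplicity G len (two_point x y) (4 / R) = 1"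
    unfolding eigen_multiplicity_def 0 1
    using V.dim_span_eq_card_independent[of "{one}"] V.dim_span_eq_card_independent[of "{h}"]
    by (simp_all del: V.dim_span add: V.dependent_single)
  have "(\<Sum>\<nu>\<in>{0, 4 / R}. eigen_multiplicity G len (two_point x y) \<nu>) = 2"
    using R dims by simp
  then have "eigenvalue G len (two_point x y) 1 \<le> ereal (4 / R)"
    unfolding eigenvalue_def using R
    by (intro Inf_lower CollectI exI[of _ "4 / R"] conjI refl exI[of _ "{0, 4 / R}"]) auto
  also have "4 / R \<le> 4 * total_length G len / (gdist G len x y)\<^sup>2"
    using dR R d by (simp add: divide_simps mult.commute)
  finally show ?thesis by simp
qed

end

text \<open>Any \<open>c\<close> above the claimed bound leaves room for a pair of points whose
  distance, though perhaps below the diameter, still satisfies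
  \<open>4 * ?L / (gdist G len x y)^2 \<le> c\<close>.\<close>

lemma eigenvalue_min_1_le: "eigenvalue_min G len 1 \<le> ereal (4 * total_length G len / (gdiam G len)\<^sup>2)"
proof (rule dense_ge)
  fix z assume z: "ereal (4 * total_length G len / (gdiam G len)\<^sup>2) < z"
  let ?L = "total_length G len" and ?D = "gdiam G len"
  have L: "0 \<le> ?L" unfolding total_length_def by (intro sum_nonneg) (auto simp: len_pos less_imp_le)
  show "eigenvalue_min G len 1 \<le> z"
  proof (cases z)
    case (real c)
    then have c: "4 * ?L / ?D\<^sup>2 < c" using z by simp
    then have c0: "0 < c" using L by (smt (verit) divide_nonneg_nonneg zero_le_power2)
    have "4 * ?L / c < ?D\<^sup>2" using c c0 gdiam_pos by (simp add: divide_simps mult.commute)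
    then have "sqrt (4 * ?L / c) < ?D" using gdiam_pos by (intro real_less_lsqrt) auto
    then obtain x y where xy: "x \<in> gpoints G len" "y \<in> gpoints G len" "sqrt (4 * ?L / c) < gdist G len x y"
      by (rule gdiam_approx)
    have "0 \<le> sqrt (4 * ?L / c)" using L c0 by simp
    then have d: "0 < gdist G len x y" using xy(3) by linarith
    have "4 * ?L / c \<le> (gdist G len x y)\<^sup>2" using xy(3) by (intro sqrt_le_D) simp
    then have *: "4 * ?L / (gdist G len x y)\<^sup>2 \<le> c" using c0 d by (simp add: divide_simps mult.commute)
    have "eigenvalue_min G len 1 \<le> eigenvalue G len (two_point x y) 1"
      unfolding eigenvalue_min_def using borel_prob_two_point[OF xy(1,2)] by (intro INF_lower) simp
    also have "\<dots> \<le> ereal (4 * ?L / (gdist G len x y)\<^sup>2)" by (rule eigenvalue_two_point_le[OF xy(1,2) d])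
    also have "\<dots> \<le> z" using * real by simp
    finally show ?thesis .
  qed (use z in auto)
qed

end

theorem corollary6p4:
  fixes G :: "('v, 'e) pre_digraph" and len :: "'e \<Rightarrow> real"
  assumes "metric_graph G len"
  shows "ereal (4 * total_length G len / (gdiam G len)\<^sup>2) \<ge> eigenvalue_min G len 1 \<and>
    eigenvalue_min G len 1 \<ge> ereal (4 / gdiam G len)"
proof
  interpret metric_graph G len by fact
  show "eigenvalue_min G len 1 \<le> ereal (4 * total_length G len / (gdiam G len)\<^sup>2)"
    by (rule eigenvalue_min_1_le)
  show "ereal (4 / gdiam G len) \<le> eigenvalue_min G len 1"
    unfolding eigenvalue_min_def by (rule INF_greatest, rule eigenvalue_1_ge) simp
qed

end
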